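(* Let $r\ge 0$ be an integer. For each $p\in \mathring{\mathcal V}_r^2(T^{\rm ps})$ there exists $v\in \mathring L_{r+1}^1(T^{\rm ps})$ such that $\operatorname{div} v=p$.
   Context: Let $T\subset\mathbb R^2$ be a (closed, nondegenerate) triangle with vertices $z_1,z_2,z_3$, labelled counter-clockwise, and let $z_0$ be a point in the interior of $T$. Let $e_i=[z_{i+1},z_{i+2}]$ (indices $1,2,3$ modulo $3$) be the edge of $T$ opposite $z_i$, and let $z_{3+i}$ be a point in the relative interior of $e_i$, $i=1,2,3$. The Powell--Sabin split $T^{\rm ps}=\{T_1,\dots,T_6\}$ is the triangulation of $T$ obtained by connecting $z_0$ to each of $z_1,\dots,z_6$. $\mathcal P_r(S)$ is the space of polynomials of degree $\le r$ on $S$, and $\mathcal P_r(T^{\rm ps})=\{q\in L^2(T): q|_S\in\mathcal P_r(S)\ \forall S\in T^{\rm ps}\}$. - $\mathring L_r^1(T^{\rm ps})$ is the space of vector fields $v=(v_1,v_2)$ whose components lie in $\mathcal P_r(T^{\rm ps})\cap C(T)$ and vanish on $\partial T$. - $\mathcal V_r^2(T^{\rm ps})=\{q\in\mathcal P_r(T^{\rm ps}): q \text{ is continuous at } z_4,z_5,z_6\}$ (i.e. the values at $z_{3+i}$ of the restrictions of $q$ to the two triangles of $T^{\rm ps}$ containing $z_{3+i}$ coincide), and $\mathring{\mathcal V}_r^2(T^{\rm ps})=\{q\in\mathcal V_r^2(T^{\rm ps}): \int_T q=0\}$. *)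

theory Defs
  imports "HOL-Analysis.Analysis"
begin

text \<open>
  A Powell--Sabin configuration is given by its points \<open>z 0, ..., z 6\<close>. The functions
  \<open>nxt\<close> and \<open>prv\<close> are the index shifts by 1 and 2 modulo 3 on the
  representatives \<open>{1, 2, 3}\<close>.
\<close>

definition nxt :: "nat \<Rightarrow> nat" where
  "nxt i = i mod 3 + 1"

definition prv :: "nat \<Rightarrow> nat" where
  "prv i = (i + 1) mod 3 + 1"

definition ps_triangle :: "(nat \<Rightarrow> real^2) \<Rightarrow> (real^2) set" where
  "ps_triangle z = convex hull {z 1, z 2, z 3}"

text \<open>Positivity of the determinant says both that the triangle is nondegenerate and that
  its vertices are labelled counter-clockwise.\<close>

definition powell_sabin :: "(nat \<Rightarrow> real^2) \<Rightarrow> bool" where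
  "powell_sabin z \<longleftrightarrow>
     det (vector [z 2 - z 1, z 3 - z 1] :: real^2^2) > 0 \<and>
     z 0 \<in> interior (ps_triangle z) \<and>
     (\<forall>i\<in>{1, 2, 3}. z (3 + i) \<in> rel_interior (closed_segment (z (nxt i)) (z (prv i))))"

definition ps_split :: "(nat \<Rightarrow> real^2) \<Rightarrow> (real^2) set set" where
  "ps_split z =
     (\<Union>i\<in>{1, 2, 3}. {convex hull {z 0, z (nxt i), z (3 + i)},
                      convex hull {z 0, z (3 + i), z (prv i)}})"

definition poly2 :: "nat \<Rightarrow> (real^2 \<Rightarrow> real) set" where
  "poly2 r = {f. \<exists>c. \<forall>x. f x = (\<Sum>i\<le>r. \<Sum>j\<le>r - i. c i j * (x $ 1) ^ i * (x $ 2) ^ j)}"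

text \<open>
  Elements of \<open>L\<^sup>2\<close> are represented by functions on the whole plane, of which only the
  values on the triangle, up to null sets, matter. Accordingly, the restriction of \<open>q\<close> to
  a subtriangle \<open>S\<close> being the polynomial \<open>f\<close> means equality almost everywhere
  on \<open>S\<close>. Since \<open>S\<close> has nonempty interior, \<open>f\<close> is then unique.
\<close>

definition L2 :: "(real^2) set \<Rightarrow> (real^2 \<Rightarrow> real) set" where
  "L2 S = {q. q \<in> borel_measurable (lebesgue_on S) \<and> integrable (lebesgue_on S) (\<lambda>x. (q x)\<^sup>2)}"

definition restricts_to :: "(real^2 \<Rightarrow> real) \<Rightarrow> (real^2) set \<Rightarrow> (real^2 \<Rightarrow> real) \<Rightarrow> bool" where
  "restricts_to q S f \<longleftrightarrow> (AE x in lebesgue_on S. q x = f x)"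

definition pw_poly :: "nat \<Rightarrow> (nat \<Rightarrow> real^2) \<Rightarrow> (real^2 \<Rightarrow> real) set" where
  "pw_poly r z = {q \<in> L2 (ps_triangle z). \<forall>S\<in>ps_split z. \<exists>f\<in>poly2 r. restricts_to q S f}"

definition L1_ring :: "nat \<Rightarrow> (nat \<Rightarrow> real^2) \<Rightarrow> (real^2 \<Rightarrow> real^2) set" where
  "L1_ring r z = {v. \<forall>k. (\<lambda>x. v x $ k) \<in> pw_poly r z \<and>
                        continuous_on (ps_triangle z) (\<lambda>x. v x $ k) \<and>
                        (\<forall>x\<in>frontier (ps_triangle z). v x $ k = 0)}"

definition V2 :: "nat \<Rightarrow> (nat \<Rightarrow> real^2) \<Rightarrow> (real^2 \<Rightarrow> real) set" where
  "V2 r z = {q \<in> pw_poly r z.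
     \<forall>i\<in>{1, 2, 3}. \<forall>S\<in>ps_split z. \<forall>S'\<in>ps_split z. z (3 + i) \<in> S \<inter> S' \<longrightarrow>
       (\<forall>f\<in>poly2 r. \<forall>g\<in>poly2 r. restricts_to q S f \<and> restricts_to q S' g \<longrightarrow>
          f (z (3 + i)) = g (z (3 + i)))}"

definition V2_ring :: "nat \<Rightarrow> (nat \<Rightarrow> real^2) \<Rightarrow> (real^2 \<Rightarrow> real) set" where
  "V2_ring r z = {q \<in> V2 r z. integral\<^sup>L (lebesgue_on (ps_triangle z)) q = 0}"

definition divergence :: "(real^2 \<Rightarrow> real^2) \<Rightarrow> real^2 \<Rightarrow> real" where
  "divergence v x = trace (jacobian v (at x))"

text \<open>
  Equality of \<open>div v\<close> and \<open>p\<close> as elements of \<open>L\<^sup>2\<close>. A field in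
  \<open>L1_ring\<close> is smooth in the interior of each subtriangle, and by continuity its weak
  divergence is the one computed there. Differentiability is asserted explicitly because
  the Jacobian is a default value where \<open>v\<close> is not differentiable.
\<close>

definition has_divergence_on ::
    "(real^2 \<Rightarrow> real^2) \<Rightarrow> (real^2 \<Rightarrow> real) \<Rightarrow> (real^2) set \<Rightarrow> bool" where
  "has_divergence_on v p T \<longleftrightarrow>
     (AE x in lebesgue_on T. v differentiable (at x) \<and> divergence v x = p x)"

end

theory Submission
  imports Defs
begin

text \<open>
  Let \<open>\<mu>\<close> be the piecewise linear function with value 1 at \<open>z 0\<close> that vanishes on the
  boundary. A piecewise polynomial \<open>P\<close> of degree \<open>r > 0\<close> that is continuous at
  the points \<open>z (3 + i)\<close> satisfies \<open>\<mu>\<^sup>k P = div (\<mu>\<^sup>k\<^sup>+\<^sup>1 w) + \<mu>\<^sup>k\<^sup>+\<^sup>1 Q\<close> with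
  a continuous field \<open>w\<close> of degree \<open>r\<close> and \<open>Q\<close> of degree \<open>r - 1\<close>. The
  normal component of \<open>w\<close> on the boundary is forced to be \<open>P / (k + 1)\<close>, up to
  scaling. This is consistent at the corners, where two independent normals meet, and at
  \<open>z (3 + i)\<close> by continuity of \<open>P\<close>. The tangential component at \<open>z (3 + i)\<close> is
  free and is chosen so that \<open>Q\<close> is again continuous there. After \<open>r\<close> steps, starting
  from \<open>k = 0\<close>, the remainder is \<open>c\<^sub>i \<mu>\<^sup>r\<close> on the part of the triangle adjacent to the
  \<open>i\<close>-th edge. The field \<open>\<mu>\<^sup>r\<^sup>+\<^sup>1 a\<close>, with a constant vector \<open>a\<close>,
  removes two of the three constants, and the third one vanishes because the mean of
  \<open>p\<close> and of every divergence is zero.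
\<close>

section \<open>Polynomials in two variables\<close>

lemma poly2_add: "f \<in> poly2 r \<Longrightarrow> g \<in> poly2 r \<Longrightarrow> (\<lambda>x. f x + g x) \<in> poly2 r"
proof -
  assume "f \<in> poly2 r" "g \<in> poly2 r"
  then obtain c d where
    "\<And>x. f x = (\<Sum>i\<le>r. \<Sum>j\<le>r - i. c i j * (x $ 1) ^ i * (x $ 2) ^ j)"
    "\<And>x. g x = (\<Sum>i\<le>r. \<Sum>j\<le>r - i. d i j * (x $ 1) ^ i * (x $ 2) ^ j)"
    by (auto simp: poly2_def)
  then show ?thesis
    unfolding poly2_def
    by (auto intro!: exI[of _ "\<lambda>i j. c i j + d i j"] simp: sum.distrib algebra_simps)
qed

lemma poly2_zero: "(\<lambda>x. 0) \<in> poly2 r"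
  unfolding poly2_def by (auto intro!: exI[of _ "\<lambda>i j. 0"])

lemma poly2_sum: "(\<And>k. k \<in> K \<Longrightarrow> f k \<in> poly2 r) \<Longrightarrow> (\<lambda>x. \<Sum>k\<in>K. f k x) \<in> poly2 r"
  by (induction K rule: infinite_finite_induct) (auto intro: poly2_zero poly2_add)

lemma poly2_monomial:
  assumes "a + b \<le> r"
  shows "(\<lambda>x. s * (x $ 1) ^ a * (x $ 2) ^ b) \<in> poly2 r"
proof -
  have *: "(\<Sum>j\<le>r - i. (if i = a \<and> j = b then s else 0) * (x $ 1) ^ i * (x $ 2) ^ j)
      = (if i = a then s * (x $ 1) ^ a * (x $ 2) ^ b else 0)" for i and x :: "real^2"
  proof (cases "i = a")
    case True
    then have "(\<Sum>j\<le>r - i. (if i = a \<and> j = b then s else 0) * (x $ 1) ^ i * (x $ 2) ^ j)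
      = (\<Sum>j\<le>r - i. if j = b then s * (x $ 1) ^ a * (x $ 2) ^ j else 0)"
      by (intro sum.cong) auto
    then show ?thesis using True assms by (simp add: sum.delta)
  qed simp
  show ?thesis unfolding poly2_def
    by (rule CollectI, rule exI[of _ "\<lambda>i j. if i = a \<and> j = b then s else 0"])
      (use assms in \<open>auto simp: * sum.delta\<close>)
qed

text \<open>The coefficient family is unpacked once here; later statements about all polynomials of
  bounded degree only need closure under sums and the monomial case.\<close>

lemma poly2_induct [consumes 1, case_names zero add monomial]:
  assumes "f \<in> poly2 r"
    and zero: "P (\<lambda>x. 0)"
    and add: "\<And>f g. P f \<Longrightarrow> P g \<Longrightarrow> P (\<lambda>x. f x + g x)"
    and mono: "\<And>s a b. a + b \<le> r \<Longrightarrow> P (\<lambda>x. s * (x $ 1) ^ a * (x $ 2) ^ b)"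
  shows "P f"
proof -
  obtain c where c: "f = (\<lambda>x. \<Sum>i\<le>r. \<Sum>j\<le>r - i. c i j * (x $ 1) ^ i * (x $ 2) ^ j)"
    using assms(1) by (auto simp: poly2_def)
  have sum: "P (\<lambda>x. \<Sum>k\<in>K. h k x)" if "\<And>k. k \<in> K \<Longrightarrow> P (h k)" for K :: "nat set" and h
    using that by (induction K rule: infinite_finite_induct) (auto intro: zero add)
  show ?thesis unfolding c by (intro sum mono) auto
qed

lemma poly2_const: "(\<lambda>x. s) \<in> poly2 r"
  using poly2_monomial[of 0 0 r s] by simp

lemma poly2_0E: "f \<in> poly2 0 \<Longrightarrow> f x = f y"
  unfolding poly2_def by auto

lemma poly2_mono:
  assumes "f \<in> poly2 r" "r \<le> s" shows "f \<in> poly2 s"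
  using assms(1)
  by (induction rule: poly2_induct) (use assms(2) in \<open>auto intro: poly2_zero poly2_add poly2_monomial\<close>)

lemma poly2_mult:
  assumes "f \<in> poly2 r" "g \<in> poly2 s"
  shows "(\<lambda>x. f x * g x) \<in> poly2 (r + s)"
  using assms(1)
proof (induction rule: poly2_induct)
  case (add f1 f2)
  then show ?case using poly2_add by (fastforce simp: ring_distribs)
next
  case (monomial c a b)
  show ?case using assms(2)
  proof (induction rule: poly2_induct)
    case (add f1 f2)
    then show ?case using poly2_add by (fastforce simp: ring_distribs)
  next
    case (monomial d a' b')
    then show ?case
      using poly2_monomial[of "a + a'" "b + b'" "r + s" "c * d"] \<open>a + b \<le> r\<close>
      by (simp add: power_add algebra_simps)
  qed (simp add: poly2_zero)
qed (simp add: poly2_zero)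

lemma poly2_scale: "f \<in> poly2 r \<Longrightarrow> (\<lambda>x. s * f x) \<in> poly2 r"
  using poly2_mult[OF poly2_const[of s 0]] by simp

lemma poly2_diff: "f \<in> poly2 r \<Longrightarrow> g \<in> poly2 r \<Longrightarrow> (\<lambda>x. f x - g x) \<in> poly2 r"
  using poly2_add[OF _ poly2_scale[of g r "- 1"]] by simp

lemma poly2_mult_Suc:
  "f \<in> poly2 1 \<Longrightarrow> g \<in> poly2 r \<Longrightarrow> (\<lambda>x. f x * g x) \<in> poly2 (Suc r)"
  using poly2_mult[of f 1 g r] by simp

lemma poly2_coord: "(\<lambda>x. x $ 1) \<in> poly2 1" "(\<lambda>x. x $ 2) \<in> poly2 1"
  using poly2_monomial[of 1 0 1 1] poly2_monomial[of 0 1 1 1] by auto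

lemma poly2_power: "f \<in> poly2 r \<Longrightarrow> (\<lambda>x. f x ^ k) \<in> poly2 (k * r)"
  by (induction k) (use poly2_const poly2_mult in auto)

text \<open>Each nonconstant monomial releases one factor, \<open>x $ 1\<close> if it occurs and
  \<open>x $ 2\<close> otherwise, which lowers its degree by one.\<close>

lemma poly2_SucE:
  assumes "f \<in> poly2 (Suc r)"
  obtains c g h where "g \<in> poly2 r" "h \<in> poly2 r" "\<And>x. f x = c + x $ 1 * g x + x $ 2 * h x"
proof -
  have "\<exists>c. \<exists>g\<in>poly2 r. \<exists>h\<in>poly2 r. \<forall>x. f x = c + x $ 1 * g x + x $ 2 * h x"
    using assms
  proof (induction rule: poly2_induct)
    case zero
    show ?case
      by (intro exI[of _ 0] bexI[of _ "\<lambda>x. 0"]) (auto intro: poly2_zero)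
  next
    case (add f1 f2)
    then obtain c g h c' g' h' where *: "g \<in> poly2 r" "h \<in> poly2 r" "g' \<in> poly2 r" "h' \<in> poly2 r"
      "\<And>x. f1 x = c + x $ 1 * g x + x $ 2 * h x" "\<And>x. f2 x = c' + x $ 1 * g' x + x $ 2 * h' x"
      by auto
    show ?case
      by (rule exI[of _ "c + c'"], rule bexI[of _ "\<lambda>x. g x + g' x"],
          rule bexI[of _ "\<lambda>x. h x + h' x"]) (auto simp: * poly2_add algebra_simps)
  next
    case (monomial s a b)
    consider "a = 0" "b = 0" | a' where "a = Suc a'" | b' where "a = 0" "b = Suc b'"
      by (meson not0_implies_Suc)
    then show ?case
    proof cases
      case 1
      then show ?thesis
        by (intro exI[of _ s] bexI[of _ "\<lambda>x. 0"]) (auto intro: poly2_zero)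
    next
      case 2
      then show ?thesis using monomial
        by - (rule exI[of _ 0], rule bexI[of _ "\<lambda>x. s * (x $ 1) ^ a' * (x $ 2) ^ b"],
            rule bexI[of _ "\<lambda>x. 0"], auto intro: poly2_zero poly2_monomial)
    next
      case 3
      then show ?thesis using monomial poly2_monomial[of 0 b' r s]
        by - (rule exI[of _ 0], rule bexI[of _ "\<lambda>x. 0"],
            rule bexI[of _ "\<lambda>x. s * (x $ 1) ^ a * (x $ 2) ^ b'"], auto intro: poly2_zero poly2_monomial)
    qed
  qed
  then show thesis using that by auto
qed

lemma poly2_has_derivative:
  assumes "f \<in> poly2 (Suc r)"
  obtains g h where "g \<in> poly2 r" "h \<in> poly2 r"
    "\<And>x. (f has_derivative (\<lambda>k. g x * k $ 1 + h x * k $ 2)) (at x)"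
proof -
  have "\<exists>g\<in>poly2 r. \<exists>h\<in>poly2 r. \<forall>x. (f has_derivative (\<lambda>k. g x * k $ 1 + h x * k $ 2)) (at x)"
    using assms
  proof (induction rule: poly2_induct)
    case zero
    show ?case
      by (intro bexI[of _ "\<lambda>x. 0"]) (auto intro: poly2_zero)
  next
    case (add f1 f2)
    then obtain g h g' h' where *: "g \<in> poly2 r" "h \<in> poly2 r" "g' \<in> poly2 r" "h' \<in> poly2 r"
      "\<And>x. (f1 has_derivative (\<lambda>k. g x * k $ 1 + h x * k $ 2)) (at x)"
      "\<And>x. (f2 has_derivative (\<lambda>k. g' x * k $ 1 + h' x * k $ 2)) (at x)"
      by blast
    show ?case
      by (rule bexI[of _ "\<lambda>x. g x + g' x"], rule bexI[of _ "\<lambda>x. h x + h' x"], rule allI,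
          rule has_derivative_eq_rhs[OF has_derivative_add[OF *(5,6)]])
        (auto simp: * poly2_add algebra_simps)
  next
    case (monomial s a b)
    \<comment> \<open>If \<open>a\<close> or \<open>b\<close> is zero, the truncated exponent is
      harmless because the coefficient \<open>real a\<close> or \<open>real b\<close>
      vanishes.\<close>
    let ?g = "\<lambda>x::real^2. (s * real a) * (x $ 1) ^ (a - 1) * (x $ 2) ^ b"
    let ?h = "\<lambda>x::real^2. (s * real b) * (x $ 1) ^ a * (x $ 2) ^ (b - 1)"
    have "(\<lambda>x. (s * real a) * (x $ 1) ^ (a - 1) * (x $ 2) ^ b) \<in> poly2 r"
      using monomial by (cases a) (auto intro: poly2_monomial poly2_zero)
    moreover have "(\<lambda>x. (s * real b) * (x $ 1) ^ a * (x $ 2) ^ (b - 1)) \<in> poly2 r"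
      using monomial by (cases b) (auto intro: poly2_monomial poly2_zero)
    moreover have "((\<lambda>x. s * (x $ 1) ^ a * (x $ 2) ^ b) has_derivative
      (\<lambda>k. (s * real a) * (x $ 1) ^ (a - 1) * (x $ 2) ^ b * k $ 1
         + (s * real b) * (x $ 1) ^ a * (x $ 2) ^ (b - 1) * k $ 2)) (at x)" for x :: "real^2"
      by (auto intro!: derivative_eq_intros bounded_linear_imp_has_derivative
          bounded_linear_vec_nth simp: algebra_simps)
    ultimately show ?case
      by - (rule bexI[of _ ?g], rule bexI[of _ ?h], rule allI)
  qed
  then show thesis using that by blast
qed

text \<open>Polynomials vanishing at the vertex \<open>q0\<close> lie in the ideal generated by the
  two barycentric coordinates vanishing there, with quotients of one degree less. Rewriting
  \<open>x $ k\<close> in these coordinates inside \<open>poly2_SucE\<close> gives the quotients up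
  to a term weighted by the coordinates of \<open>q0\<close>.\<close>

lemma poly2_expand_Suc:
  fixes l0 l1 l2 :: "real^2 \<Rightarrow> real"
  assumes sum: "\<And>x. l0 x + l1 x + l2 x = 1"
    and repr: "\<And>x. x = l0 x *\<^sub>R q0 + l1 x *\<^sub>R q1 + l2 x *\<^sub>R q2"
    and q0: "l1 q0 = 0" "l2 q0 = 0"
    and f: "f \<in> poly2 (Suc r)"
  obtains g h where "g \<in> poly2 r" "h \<in> poly2 r" "\<And>x. f x = f q0 + l1 x * g x + l2 x * h x"
proof -
  have co: "x $ k = q0 $ k + l1 x * (q1 - q0) $ k + l2 x * (q2 - q0) $ k" for x k
  proof -
    have *: "l0 x = 1 - l1 x - l2 x" using sum[of x] by simp
    show ?thesis using arg_cong[OF repr[of x], of "\<lambda>y. y $ k"] unfolding * by (simp add: algebra_simps)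
  qed
  have "\<exists>c. \<exists>g\<in>poly2 r. \<exists>h\<in>poly2 r. \<forall>x. f x = c + l1 x * g x + l2 x * h x"
    using f
  proof (induction r arbitrary: f)
    case 0
    obtain c g h where gh: "g \<in> poly2 0" "h \<in> poly2 0" "\<And>x. f x = c + x $ 1 * g x + x $ 2 * h x"
      using poly2_SucE[OF 0] by metis
    have gh0: "g x = g 0" "h x = h 0" for x using gh poly2_0E by auto
    have "f x = (c + q0 $ 1 * g 0 + q0 $ 2 * h 0) +
        l1 x * ((q1 - q0) $ 1 * g 0 + (q1 - q0) $ 2 * h 0) +
        l2 x * ((q2 - q0) $ 1 * g 0 + (q2 - q0) $ 2 * h 0)" for x
    proof -
      have "f x = c + (q0 $ 1 + l1 x * (q1 - q0) $ 1 + l2 x * (q2 - q0) $ 1) * g 0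
        + (q0 $ 2 + l1 x * (q1 - q0) $ 2 + l2 x * (q2 - q0) $ 2) * h 0"
        using gh(3)[of x] co[of x 1] co[of x 2] gh0[of x] by simp
      then show ?thesis by (simp add: algebra_simps del: vector_minus_component)
    qed
    then show ?case
      by - (rule exI, rule bexI[of _ "\<lambda>x. (q1 - q0) $ 1 * g 0 + (q1 - q0) $ 2 * h 0"],
        rule bexI[of _ "\<lambda>x. (q2 - q0) $ 1 * g 0 + (q2 - q0) $ 2 * h 0"],
        rule allI, assumption, rule poly2_const, rule poly2_const)
  next
    case (Suc r)
    obtain c g h where gh: "g \<in> poly2 (Suc r)" "h \<in> poly2 (Suc r)"
      "\<And>x. f x = c + x $ 1 * g x + x $ 2 * h x"
      using poly2_SucE[OF Suc.prems] by metis
    \<comment> \<open>This leftover term has one degree less than \<open>f\<close>, so the induction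
      hypothesis splits it in turn.\<close>
    have "(\<lambda>x. q0 $ 1 * g x + q0 $ 2 * h x) \<in> poly2 (Suc r)"
      by (intro poly2_add poly2_scale gh)
    from Suc.IH[OF this] obtain c' g' h' where gh': "g' \<in> poly2 r" "h' \<in> poly2 r"
      "\<And>x. q0 $ 1 * g x + q0 $ 2 * h x = c' + l1 x * g' x + l2 x * h' x"
      by blast
    have mono: "g' \<in> poly2 (Suc r)" "h' \<in> poly2 (Suc r)"
      using gh' poly2_mono[of _ r "Suc r"] by auto
    have "f x = (c + c') +
        l1 x * (g' x + ((q1 - q0) $ 1 * g x + (q1 - q0) $ 2 * h x)) +
        l2 x * (h' x + ((q2 - q0) $ 1 * g x + (q2 - q0) $ 2 * h x))" for x
    proof -
      have "f x = c + (q0 $ 1 + l1 x * (q1 - q0) $ 1 + l2 x * (q2 - q0) $ 1) * g x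
        + (q0 $ 2 + l1 x * (q1 - q0) $ 2 + l2 x * (q2 - q0) $ 2) * h x"
        using gh(3)[of x] co[of x 1] co[of x 2] by simp
      also have "\<dots> = c + (q0 $ 1 * g x + q0 $ 2 * h x)
        + l1 x * ((q1 - q0) $ 1 * g x + (q1 - q0) $ 2 * h x)
        + l2 x * ((q2 - q0) $ 1 * g x + (q2 - q0) $ 2 * h x)"
        by (simp add: algebra_simps del: vector_minus_component)
      finally show ?thesis unfolding gh'(3) by (simp add: algebra_simps)
    qed
    moreover have "(\<lambda>x. g' x + ((q1 - q0) $ 1 * g x + (q1 - q0) $ 2 * h x)) \<in> poly2 (Suc r)"
      "(\<lambda>x. h' x + ((q2 - q0) $ 1 * g x + (q2 - q0) $ 2 * h x)) \<in> poly2 (Suc r)"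
      by (intro poly2_add poly2_scale gh mono)+
    ultimately show ?case
      by - (rule exI, rule bexI[of _ "\<lambda>x. g' x + ((q1 - q0) $ 1 * g x + (q1 - q0) $ 2 * h x)"],
        rule bexI[of _ "\<lambda>x. h' x + ((q2 - q0) $ 1 * g x + (q2 - q0) $ 2 * h x)"],
        rule allI, assumption)
  qed
  then obtain c g h where *: "g \<in> poly2 r" "h \<in> poly2 r" "\<And>x. f x = c + l1 x * g x + l2 x * h x"
    by blast
  moreover have "c = f q0" using *(3)[of q0] q0 by simp
  ultimately show thesis using that by blast
qed

text \<open>Includes degree zero, where both quotients vanish. That their degree is
  \<open>r - 1\<close> is expressed through products with linear polynomials, because with truncated
  subtraction the bound would be too weak at \<open>r = 0\<close>.\<close>

lemma poly2_expand:
  fixes l0 l1 l2 :: "real^2 \<Rightarrow> real"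
  assumes "\<And>x. l0 x + l1 x + l2 x = 1"
    and "\<And>x. x = l0 x *\<^sub>R q0 + l1 x *\<^sub>R q1 + l2 x *\<^sub>R q2"
    and "l1 q0 = 0" "l2 q0 = 0"
    and f: "f \<in> poly2 r"
  obtains g h where "g \<in> poly2 r" "h \<in> poly2 r"
    "\<And>a. a \<in> poly2 1 \<Longrightarrow> (\<lambda>x. a x * g x) \<in> poly2 r"
    "\<And>a. a \<in> poly2 1 \<Longrightarrow> (\<lambda>x. a x * h x) \<in> poly2 r"
    "\<And>x. f x = f q0 + l1 x * g x + l2 x * h x"
proof (cases r)
  case 0
  have "f x = f q0 + l1 x * 0 + l2 x * 0" for x
    using f poly2_0E[of f x q0] 0 by simp
  then show thesis using that[of "\<lambda>x. 0" "\<lambda>x. 0"] by (auto simp: poly2_zero)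
next
  case (Suc k)
  then obtain g h where gh: "g \<in> poly2 k" "h \<in> poly2 k" "\<And>x. f x = f q0 + l1 x * g x + l2 x * h x"
    using poly2_expand_Suc[OF assms(1-4)] f by metis
  moreover have "g \<in> poly2 r" "h \<in> poly2 r" using gh poly2_mono[of _ k r] Suc by auto
  moreover have "(\<lambda>x. a x * g x) \<in> poly2 r" "(\<lambda>x. a x * h x) \<in> poly2 r" if "a \<in> poly2 1" for a
    using gh poly2_mult_Suc[OF that] Suc by auto
  ultimately show thesis by (intro that[of g h])
qed

section \<open>The divergence theorem for fields with compact support\<close>

definition vpoly2 :: "nat \<Rightarrow> (real^2 \<Rightarrow> real^2) set" where
  "vpoly2 r = {v. \<forall>k. (\<lambda>x. v x $ k) \<in> poly2 r}"

lemma vpoly2_sum: "(\<And>k. k \<in> K \<Longrightarrow> v k \<in> vpoly2 r) \<Longrightarrow> (\<lambda>x. \<Sum>k\<in>K. v k x) \<in> vpoly2 r"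
  by (auto simp: vpoly2_def intro: poly2_sum)

lemma vpoly2_scaleR:
  "f \<in> poly2 r \<Longrightarrow> v \<in> vpoly2 s \<Longrightarrow> (\<lambda>x. f x *\<^sub>R v x) \<in> vpoly2 (r + s)"
  by (auto simp: vpoly2_def intro: poly2_mult)

lemma vpoly2_const: "(\<lambda>x. a) \<in> vpoly2 r"
  by (auto simp: vpoly2_def intro: poly2_const)

lemma vpoly2_mono: "v \<in> vpoly2 r \<Longrightarrow> r \<le> s \<Longrightarrow> v \<in> vpoly2 s"
  by (auto simp: vpoly2_def intro: poly2_mono)

lemma vpoly2_scaleR_const: "f \<in> poly2 r \<Longrightarrow> (\<lambda>x. f x *\<^sub>R a) \<in> vpoly2 r"
  using vpoly2_scaleR[of f r "\<lambda>x. a" 0] vpoly2_const by simp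

lemma poly2_inner: "v \<in> vpoly2 r \<Longrightarrow> (\<lambda>x. a \<bullet> v x) \<in> poly2 r"
  by (auto simp: vpoly2_def inner_vec_def sum_2 intro!: poly2_add poly2_scale)

lemma divergence_eq:
  fixes v :: "real^2 \<Rightarrow> real^2"
  assumes "(v has_derivative v') (at x)"
  shows "divergence v x = v' (axis 1 1) $ 1 + v' (axis 2 1) $ 2"
  using frechet_derivative_at[OF assms]
  by (simp add: divergence_def jacobian_def trace_def sum_2 matrix_def)

lemma vec2_eq_axis: "v = v $ 1 *\<^sub>R axis 1 1 + v $ 2 *\<^sub>R axis 2 (1::real)" for v :: "real^2"
  by (simp add: vec_eq_iff forall_2 axis_def)

lemma has_derivative_vec2:
  fixes v :: "real^2 \<Rightarrow> real^2"
  assumes "((\<lambda>x. v x $ 1) has_derivative f) (at x)" "((\<lambda>x. v x $ 2) has_derivative g) (at x)"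
  shows "(v has_derivative (\<lambda>h. f h *\<^sub>R axis 1 1 + g h *\<^sub>R axis 2 1)) (at x)"
  by (subst vec2_eq_axis[of "v _", abs_def]) (intro has_derivative_add has_derivative_scaleR_left assms)

lemma vpoly2_has_derivative:
  assumes "v \<in> vpoly2 (Suc r)"
  shows "v differentiable (at x)" "divergence v \<in> poly2 r"
proof -
  obtain g1 h1 where 1: "g1 \<in> poly2 r" "h1 \<in> poly2 r"
    "\<And>x. ((\<lambda>x. v x $ 1) has_derivative (\<lambda>k. g1 x * k $ 1 + h1 x * k $ 2)) (at x)"
    using assms poly2_has_derivative[of "\<lambda>x. v x $ 1" r] by (auto simp: vpoly2_def)
  obtain g2 h2 where 2: "g2 \<in> poly2 r" "h2 \<in> poly2 r"
    "\<And>x. ((\<lambda>x. v x $ 2) has_derivative (\<lambda>k. g2 x * k $ 1 + h2 x * k $ 2)) (at x)"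
    using assms poly2_has_derivative[of "\<lambda>x. v x $ 2" r] by (auto simp: vpoly2_def)
  note d = has_derivative_vec2[OF 1(3) 2(3)]
  show "v differentiable (at x)" using d by (rule differentiableI)
  have "divergence v = (\<lambda>x. g1 x + h2 x)"
    using divergence_eq[OF d] by (auto simp: fun_eq_iff axis_def)
  then show "divergence v \<in> poly2 r" using 1 2 by (simp add: poly2_add)
qed

lemma vpoly2_differentiable: "v \<in> vpoly2 r \<Longrightarrow> v differentiable (at x)"
  using vpoly2_has_derivative(1)[OF vpoly2_mono[of v r "Suc r"]] by simp

lemma divergence_add:
  fixes v w :: "real^2 \<Rightarrow> real^2"
  assumes "v differentiable (at x)" "w differentiable (at x)"
  shows "divergence (\<lambda>x. v x + w x) x = divergence v x + divergence w x"
proof -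
  obtain v' w' where *: "(v has_derivative v') (at x)" "(w has_derivative w') (at x)"
    using assms by (auto simp: differentiable_def)
  show ?thesis using divergence_eq[OF has_derivative_add[OF *]] *[THEN divergence_eq] by simp
qed

lemma divergence_scaleR:
  fixes v :: "real^2 \<Rightarrow> real^2"
  assumes f: "(f has_derivative f') (at x)" and "v differentiable (at x)"
  shows "divergence (\<lambda>x. f x *\<^sub>R v x) x = f' (v x) + f x * divergence v x"
proof -
  obtain v' where v: "(v has_derivative v') (at x)"
    using assms by (auto simp: differentiable_def)
  interpret bounded_linear f' using f by (rule has_derivative_bounded_linear)
  have "f' (v x) = f' (axis 1 1) * v x $ 1 + f' (axis 2 1) * v x $ 2"
    by (subst vec2_eq_axis) (simp only: add scale real_scaleR_def mult.commute)
  then show ?thesis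
    using divergence_eq[OF has_derivative_scaleR[OF f v]] divergence_eq[OF v]
    by (simp add: algebra_simps)
qed

lemma divergence_const: "divergence (\<lambda>x. a) x = 0"
  using divergence_eq[OF has_derivative_const[of a]] by simp

lemma divergence_scaleR_const:
  assumes f: "(f has_derivative f') (at x)"
  shows "divergence (\<lambda>x. f x *\<^sub>R a) x = f' a"
  using divergence_scaleR[OF f, of "\<lambda>x. a"] by (simp add: divergence_const)

section \<open>Locally Lipschitz functions\<close>

definition loc_lipschitz :: "(real^2 \<Rightarrow> real) \<Rightarrow> bool" where
  "loc_lipschitz f \<longleftrightarrow> (\<forall>R. \<exists>L. L-lipschitz_on (cball 0 R) f)"

lemma loc_lipschitz_obtain:
  assumes "loc_lipschitz f"
  obtains L B where "L-lipschitz_on (cball 0 R) f" "\<And>x. norm x \<le> R \<Longrightarrow> \<bar>f x\<bar> \<le> B"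
proof -
  obtain L where L: "L-lipschitz_on (cball 0 R) f" using assms by (auto simp: loc_lipschitz_def)
  have "\<bar>f x\<bar> \<le> \<bar>f 0\<bar> + L * R" if "norm x \<le> R" for x
  proof -
    have "0 \<le> R" using norm_ge_zero[of x] that by linarith
    then have "\<bar>f x - f 0\<bar> \<le> L * norm x"
      using lipschitz_on_normD[OF L, of x 0] that by simp
    also have "\<dots> \<le> L * R" using that lipschitz_on_nonneg[OF L] by (simp add: mult_left_mono)
    finally show ?thesis by linarith
  qed
  then show thesis using L that by blast
qed

lemma loc_lipschitzI:
  assumes "\<And>R. \<exists>L. \<forall>x y. norm x \<le> R \<longrightarrow> norm y \<le> R \<longrightarrow> \<bar>f x - f y\<bar> \<le> L * norm (x - y)"
  shows "loc_lipschitz f"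
  unfolding loc_lipschitz_def
proof
  fix R
  obtain L where "\<forall>x y. norm x \<le> R \<longrightarrow> norm y \<le> R \<longrightarrow> \<bar>f x - f y\<bar> \<le> L * norm (x - y)"
    using assms by blast
  then have "\<forall>x y. norm x \<le> R \<longrightarrow> norm y \<le> R \<longrightarrow> \<bar>f x - f y\<bar> \<le> \<bar>L\<bar> * norm (x - y)"
    by (meson abs_ge_self mult_right_mono norm_ge_zero order_trans)
  then show "\<exists>L. L-lipschitz_on (cball 0 R) f"
    by (intro exI[of _ "\<bar>L\<bar>"] lipschitz_onI) (auto simp: dist_norm)
qed

lemma loc_lipschitz_const: "loc_lipschitz (\<lambda>x. c)"
  by (rule loc_lipschitzI) (auto intro: exI[of _ 0])

lemma loc_lipschitz_nth: "loc_lipschitz (\<lambda>x. x $ k)"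
  by (rule loc_lipschitzI, rule exI[of _ 1])
    (metis component_le_norm_cart mult_1 vector_minus_component)

text \<open>On a ball the values of \<open>f\<close> and \<open>g\<close> are bounded, so
  \<open>op\<close> only has to be Lipschitz on bounded sets. This treats sums, maxima, minima and
  products alike, from which the truncated hat functions and the glued fields are built.\<close>

lemma loc_lipschitz_binop:
  assumes f: "loc_lipschitz f" and g: "loc_lipschitz g"
    and op: "\<And>B. \<exists>C\<ge>0. \<forall>a b c d. \<bar>a\<bar> \<le> B \<longrightarrow> \<bar>b\<bar> \<le> B \<longrightarrow> \<bar>c\<bar> \<le> B \<longrightarrow> \<bar>d\<bar> \<le> B \<longrightarrow>
      \<bar>op a b - op c d\<bar> \<le> C * (\<bar>a - c\<bar> + \<bar>b - d\<bar>)"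
  shows "loc_lipschitz (\<lambda>x. op (f x) (g x))"
proof (rule loc_lipschitzI)
  fix R
  obtain L B where 1: "L-lipschitz_on (cball 0 R) f" "\<And>x. norm x \<le> R \<Longrightarrow> \<bar>f x\<bar> \<le> B"
    using loc_lipschitz_obtain[OF f] by metis
  obtain L' B' where 2: "L'-lipschitz_on (cball 0 R) g" "\<And>x. norm x \<le> R \<Longrightarrow> \<bar>g x\<bar> \<le> B'"
    using loc_lipschitz_obtain[OF g] by metis
  obtain C where C: "C \<ge> 0" and op: "\<And>a b c d. \<bar>a\<bar> \<le> max B B' \<Longrightarrow> \<bar>b\<bar> \<le> max B B' \<Longrightarrow>
      \<bar>c\<bar> \<le> max B B' \<Longrightarrow> \<bar>d\<bar> \<le> max B B' \<Longrightarrow> \<bar>op a b - op c d\<bar> \<le> C * (\<bar>a - c\<bar> + \<bar>b - d\<bar>)"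
    using op[of "max B B'"] by metis
  have "\<bar>op (f x) (g x) - op (f y) (g y)\<bar> \<le> C * (L + L') * norm (x - y)"
    if "norm x \<le> R" "norm y \<le> R" for x y
  proof -
    have "\<bar>op (f x) (g x) - op (f y) (g y)\<bar> \<le> C * (\<bar>f x - f y\<bar> + \<bar>g x - g y\<bar>)"
      using 1(2)[of x] 1(2)[of y] 2(2)[of x] 2(2)[of y] that
      by (intro op) (auto simp: le_max_iff_disj)
    also have "\<dots> \<le> C * (L * norm (x - y) + L' * norm (x - y))"
      using lipschitz_on_normD[OF 1(1), of x y] lipschitz_on_normD[OF 2(1), of x y] that C
      by (intro mult_left_mono add_mono) auto
    finally show ?thesis by (simp add: algebra_simps)
  qed
  then show "\<exists>L. \<forall>x y. norm x \<le> R \<longrightarrow> norm y \<le> R \<longrightarrow>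
      \<bar>op (f x) (g x) - op (f y) (g y)\<bar> \<le> L * norm (x - y)" by blast
qed

lemma loc_lipschitz_add: "loc_lipschitz f \<Longrightarrow> loc_lipschitz g \<Longrightarrow> loc_lipschitz (\<lambda>x. f x + g x)"
  by (rule loc_lipschitz_binop) (auto intro!: exI[of _ 1])

lemma loc_lipschitz_max: "loc_lipschitz f \<Longrightarrow> loc_lipschitz g \<Longrightarrow> loc_lipschitz (\<lambda>x. max (f x) (g x))"
  by (rule loc_lipschitz_binop[where op = max]) (auto intro!: exI[of _ 1])

lemma loc_lipschitz_min: "loc_lipschitz f \<Longrightarrow> loc_lipschitz g \<Longrightarrow> loc_lipschitz (\<lambda>x. min (f x) (g x))"
  by (rule loc_lipschitz_binop[where op = min]) (auto intro!: exI[of _ 1])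

lemma loc_lipschitz_mult: "loc_lipschitz f \<Longrightarrow> loc_lipschitz g \<Longrightarrow> loc_lipschitz (\<lambda>x. f x * g x)"
proof (rule loc_lipschitz_binop[where op = "(*)"])
  fix B :: real
  have "\<bar>a * b - c * d\<bar> \<le> \<bar>B\<bar> * (\<bar>a - c\<bar> + \<bar>b - d\<bar>)"
    if "\<bar>a\<bar> \<le> B" "\<bar>b\<bar> \<le> B" "\<bar>c\<bar> \<le> B" "\<bar>d\<bar> \<le> B" for a b c d
  proof -
    have "\<bar>a * b - c * d\<bar> = \<bar>(a - c) * b + c * (b - d)\<bar>" by (simp add: algebra_simps)
    also have "\<dots> \<le> \<bar>a - c\<bar> * \<bar>b\<bar> + \<bar>c\<bar> * \<bar>b - d\<bar>"
      by (metis abs_mult abs_triangle_ineq)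
    also have "\<dots> \<le> \<bar>a - c\<bar> * \<bar>B\<bar> + \<bar>B\<bar> * \<bar>b - d\<bar>"
      using that by (intro add_mono mult_left_mono mult_right_mono) auto
    finally show ?thesis by (simp add: algebra_simps)
  qed
  then show "\<exists>C\<ge>0. \<forall>a b c d. \<bar>a\<bar> \<le> B \<longrightarrow> \<bar>b\<bar> \<le> B \<longrightarrow> \<bar>c\<bar> \<le> B \<longrightarrow> \<bar>d\<bar> \<le> B \<longrightarrow>
      \<bar>a * b - c * d\<bar> \<le> C * (\<bar>a - c\<bar> + \<bar>b - d\<bar>)"
    by (intro exI[of _ "\<bar>B\<bar>"]) auto
qed

lemma loc_lipschitz_power: "loc_lipschitz f \<Longrightarrow> loc_lipschitz (\<lambda>x. f x ^ n)"
  by (induction n) (auto intro: loc_lipschitz_const loc_lipschitz_mult)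

lemma loc_lipschitz_poly2: "f \<in> poly2 r \<Longrightarrow> loc_lipschitz f"
  by (induction rule: poly2_induct)
    (auto intro!: loc_lipschitz_const loc_lipschitz_add loc_lipschitz_mult loc_lipschitz_power
      loc_lipschitz_nth)

lemma loc_lipschitz_continuous:
  assumes "loc_lipschitz f" shows "continuous_on UNIV f"
proof -
  have "isCont f x" for x
  proof -
    obtain L where "L-lipschitz_on (cball 0 (norm x + 1)) f"
      using assms by (auto simp: loc_lipschitz_def)
    then have "continuous_on (cball 0 (norm x + 1)) f" by (rule lipschitz_on_continuous_on)
    then show ?thesis
      by (rule continuous_on_interior) simp
  qed
  then show ?thesis by (simp add: continuous_at_imp_continuous_on)
qed

section \<open>Integrals of derivatives over the plane\<close>

lemma lborel_integral_translate:
  fixes f :: "'a::euclidean_space \<Rightarrow> real"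
  assumes "integrable lborel f"
  shows "integrable lborel (\<lambda>x. f (x + e))" "(\<integral>x. f (x + e) \<partial>lborel) = (\<integral>x. f x \<partial>lborel)"
proof -
  have m: "f \<in> borel_measurable borel" using borel_measurable_integrable[OF assms] by simp
  have "integrable (distr lborel borel ((+) e)) f" using assms by (simp add: lborel_distr_plus)
  then show "integrable lborel (\<lambda>x. f (x + e))"
    by (subst (asm) integrable_distr_eq) (use m in \<open>auto simp: add.commute\<close>)
  have "(\<integral>x. f x \<partial>lborel) = (\<integral>x. f x \<partial>(distr lborel borel ((+) e)))" by (simp add: lborel_distr_plus)
  also have "\<dots> = (\<integral>x. f (e + x) \<partial>lborel)" by (rule integral_distr) (use m in auto)
  finally show "(\<integral>x. f (x + e) \<partial>lborel) = (\<integral>x. f x \<partial>lborel)" by (simp add: add.commute)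
qed

text \<open>The steps \<open>1 / (n + 1)\<close> form a sequence, as dominated convergence requires,
  and being at most 1 they keep shifted points of a ball in a fixed larger ball.\<close>

lemma directional_derivative_LIMSEQ:
  fixes f :: "'a::euclidean_space \<Rightarrow> real"
  assumes "(f has_derivative f') (at x)"
  shows "(\<lambda>n. (f (x + inverse (real (Suc n)) *\<^sub>R e) - f x) / inverse (real (Suc n))) \<longlonglongrightarrow> f' e"
proof -
  interpret bounded_linear f' using assms by (rule has_derivative_bounded_linear)
  have "((\<lambda>t. x + t *\<^sub>R e) has_derivative (\<lambda>t. t *\<^sub>R e)) (at 0)"
    by (auto intro!: derivative_eq_intros)
  moreover have "(f has_derivative f') (at (x + 0 *\<^sub>R e))" using assms by simp
  ultimately have "((\<lambda>t. f (x + t *\<^sub>R e)) has_derivative (\<lambda>t. f' (t *\<^sub>R e))) (at 0)"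
    by (rule has_derivative_compose)
  then have "DERIV (\<lambda>t. f (x + t *\<^sub>R e)) 0 :> f' e"
    by (rule has_derivative_imp_has_field_derivative) (simp add: scale mult.commute)
  then have "(\<lambda>h. (f (x + (0 + h) *\<^sub>R e) - f (x + 0 *\<^sub>R e)) / h) \<midarrow>0\<rightarrow> f' e" by (rule DERIV_D)
  moreover have "filterlim (\<lambda>n. inverse (real (Suc n))) (at 0) sequentially"
    using LIMSEQ_inverse_real_of_nat by (auto simp: filterlim_at)
  ultimately show ?thesis using filterlim_compose by fastforce
qed

text \<open>The difference quotients of \<open>f\<close> integrate to zero by translation invariance and are
  dominated because \<open>f\<close> is Lipschitz. This yields the divergence theorem for fields
  vanishing at the boundary. At points where \<open>f\<close> is not differentiable, \<open>D\<close> is a junk value.\<close>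

lemma integral_directional_derivative_eq_0:
  fixes f :: "real^2 \<Rightarrow> real"
  assumes lip: "loc_lipschitz f" and supp: "\<And>x. norm x > R \<Longrightarrow> f x = 0"
    and diff: "AE x in lborel. f differentiable (at x)" and e: "norm e = 1"
  obtains D where "integrable lborel D" "(\<integral>x. D x \<partial>lborel) = 0"
    "\<And>x. f differentiable (at x) \<Longrightarrow> D x = frechet_derivative f (at x) e"
proof -
  define u where "u n x = (f (x + inverse (real (Suc n)) *\<^sub>R e) - f x) / inverse (real (Suc n))" for n x
  define D where "D x = lim (\<lambda>n. u n x)" for x
  \<comment> \<open>The difference quotients vanish beyond radius \<open>R + 1\<close>, and points
    of that ball are shifted at most to radius \<open>R + 2\<close>.\<close>
  obtain L B where L: "L-lipschitz_on (cball 0 (R + 2)) f" and B: "\<And>x. norm x \<le> R + 2 \<Longrightarrow> \<bar>f x\<bar> \<le> B"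
    using loc_lipschitz_obtain[OF lip] by metis
  have cont: "continuous_on UNIV f" using lip by (rule loc_lipschitz_continuous)
  then have meas: "f \<in> borel_measurable borel" by (rule borel_measurable_continuous_onI)
  have conv: "(\<lambda>n. u n x) \<longlonglongrightarrow> frechet_derivative f (at x) e" if "f differentiable (at x)" for x
    unfolding u_def
    by (rule directional_derivative_LIMSEQ) (use that frechet_derivative_works in blast)
  have ind: "integrable lborel (\<lambda>x::real^2. c * indicator (cball 0 (R + 1)) x)" for c :: real
    using emeasure_lborel_cball_finite[of 0 "R + 1"]
    by (intro integrable_mult_right integrable_real_indicator) auto
  have intf: "integrable lborel f"
  proof (rule Bochner_Integration.integrable_bound[OF ind[of B]])
    have "norm (f x) \<le> norm (B * indicator (cball 0 (R + 1)) x)" for x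
    proof (cases "norm x \<le> R + 1")
      case True
      then show ?thesis using B[of x] by (simp add: indicator_def)
    next
      case False
      then show ?thesis using supp[of x] by simp
    qed
    then show "AE x in lborel. norm (f x) \<le> norm (B * indicator (cball 0 (R + 1)) x)" by simp
  qed (use meas in simp)
  have zero: "(\<integral>x. u n x \<partial>lborel) = 0" for n
    unfolding u_def using lborel_integral_translate[OF intf] intf by simp
  have meas_u: "u n \<in> borel_measurable lborel" for n
    unfolding u_def using meas by measurable
  have bound: "norm (u n x) \<le> L * indicator (cball 0 (R + 1)) x" for n x
  proof -
    define t where "t = inverse (real (Suc n))"
    have t: "0 < t" "t \<le> 1" by (auto simp: t_def inverse_le_1_iff)
    have nt: "norm (x + t *\<^sub>R e) \<le> norm x + t" "norm x \<le> norm (x + t *\<^sub>R e) + t"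
      using norm_triangle_ineq[of x "t *\<^sub>R e"] norm_triangle_ineq4[of "x + t *\<^sub>R e" "t *\<^sub>R e"] t e by auto
    show ?thesis
    proof (cases "norm x \<le> R + 1")
      case True
      then have "\<bar>f (x + t *\<^sub>R e) - f x\<bar> \<le> L * t"
        using lipschitz_on_normD[OF L, of "x + t *\<^sub>R e" x] nt t e by simp
      then show ?thesis using True t
        unfolding u_def t_def[symmetric] by (simp add: abs_mult divide_le_eq mult.commute)
    next
      case False
      then show ?thesis using supp[of x] supp[of "x + t *\<^sub>R e"] nt t
        unfolding u_def t_def[symmetric] by simp
    qed
  qed
  have lim: "AE x in lborel. (\<lambda>n. u n x) \<longlonglongrightarrow> D x"
    using diff
  proof (rule AE_mp, intro AE_I2 impI)
    fix x assume "f differentiable (at x)"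
    then show "(\<lambda>n. u n x) \<longlonglongrightarrow> D x" using conv unfolding D_def by (metis limI)
  qed
  have measD: "D \<in> borel_measurable lborel"
    unfolding D_def by (rule borel_measurable_lim_metric) (rule meas_u)
  note dct = measD meas_u ind[of L] lim AE_I2[OF bound]
  have "integrable lborel D" by (rule integrable_dominated_convergence[OF dct])
  moreover have "(\<lambda>n. \<integral>x. u n x \<partial>lborel) \<longlonglongrightarrow> (\<integral>x. D x \<partial>lborel)"
    by (rule integral_dominated_convergence[OF dct])
  then have "(\<integral>x. D x \<partial>lborel) = 0" unfolding zero by (simp add: LIMSEQ_const_iff)
  moreover have "D x = frechet_derivative f (at x) e" if "f differentiable (at x)" for x
    using conv[OF that] unfolding D_def by (rule limI)
  ultimately show thesis using that by blast
qed

text \<open>Each component is differentiated in its own coordinate direction, and \<open>D\<close>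
  is the sum of the two resulting functions.\<close>

lemma integral_divergence_eq_0:
  fixes v :: "real^2 \<Rightarrow> real^2"
  assumes lip: "\<And>k. loc_lipschitz (\<lambda>x. v x $ k)" and supp: "\<And>x. norm x > R \<Longrightarrow> v x = 0"
    and diff: "AE x in lborel. v differentiable (at x)"
  obtains D where "integrable lborel D" "(\<integral>x. D x \<partial>lborel) = 0"
    "\<And>x. v differentiable (at x) \<Longrightarrow> D x = divergence v x"
proof -
  have d: "((\<lambda>x. v x $ k) has_derivative (\<lambda>h. frechet_derivative v (at x) h $ k)) (at x)"
    if "v differentiable (at x)" for x k
    using that bounded_linear.has_derivative[OF bounded_linear_vec_nth]
    unfolding frechet_derivative_works by blast
  have *: "\<exists>D. integrable lborel D \<and> (\<integral>x. D x \<partial>lborel) = 0 \<and>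
    (\<forall>x. v differentiable (at x) \<longrightarrow> D x = frechet_derivative v (at x) (axis k 1) $ k)" for k
  proof (rule integral_directional_derivative_eq_0[OF lip[of k]])
    show "\<And>x. norm x > R \<Longrightarrow> v x $ k = 0" using supp by simp
    show "AE x in lborel. (\<lambda>x. v x $ k) differentiable (at x)"
      using diff by (rule AE_mp) (use d differentiableI in \<open>blast intro: AE_I2\<close>)
    show "norm (axis k (1::real)) = 1" by simp
    fix D :: "real^2 \<Rightarrow> real"
    assume D: "integrable lborel D" "(\<integral>x. D x \<partial>lborel) = 0"
      "\<And>x. (\<lambda>x. v x $ k) differentiable (at x) \<Longrightarrow> D x = frechet_derivative (\<lambda>x. v x $ k) (at x) (axis k 1)"
    have "D x = frechet_derivative v (at x) (axis k 1) $ k" if "v differentiable (at x)" for x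
      using D(3)[OF differentiableI[OF d[OF that]]] frechet_derivative_at[OF d[OF that, of k]]
      by metis
    then show ?thesis using D by blast
  qed
  obtain D1 D2 where
    "integrable lborel D1" "(\<integral>x. D1 x \<partial>lborel) = 0"
    "\<And>x. v differentiable (at x) \<Longrightarrow> D1 x = frechet_derivative v (at x) (axis 1 1) $ 1"
    "integrable lborel D2" "(\<integral>x. D2 x \<partial>lborel) = 0"
    "\<And>x. v differentiable (at x) \<Longrightarrow> D2 x = frechet_derivative v (at x) (axis 2 1) $ 2"
    using *[of 1] *[of 2] by blast
  then show thesis
    using divergence_eq[of v "frechet_derivative v (at _)"]
    by (intro that[of "\<lambda>x. D1 x + D2 x"]) (auto simp: frechet_derivative_works)
qed

section \<open>Barycentric coordinates on the split\<close>

text \<open>Stating affineness through differences turns the inner product of a gradient with an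
  edge vector into a difference of vertex values, so gradients need not be computed in
  coordinates.\<close>

definition affine_grad :: "(real^2 \<Rightarrow> real) \<Rightarrow> real^2 \<Rightarrow> bool" where
  "affine_grad f g \<longleftrightarrow> (\<forall>x y. f x - f y = g \<bullet> (x - y))"

lemma affine_gradD: "affine_grad f g \<Longrightarrow> f x = f y + g \<bullet> (x - y)"
  unfolding affine_grad_def by (metis add.commute diff_add_cancel)

lemma affine_grad_eq: "affine_grad f g \<Longrightarrow> f = (\<lambda>x. f 0 + g \<bullet> x)"
proof
  fix x assume "affine_grad f g"
  from affine_gradD[OF this, of x 0] show "f x = f 0 + g \<bullet> x" by simp
qed

lemma affine_grad_scale: "affine_grad f g \<Longrightarrow> affine_grad (\<lambda>x. c * f x) (c *\<^sub>R g)"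
  unfolding affine_grad_def by (simp flip: right_diff_distrib)

lemma affine_grad_diff:
  "affine_grad f g \<Longrightarrow> affine_grad f' g' \<Longrightarrow> affine_grad (\<lambda>x. f x - f' x) (g - g')"
  unfolding affine_grad_def by (simp add: inner_diff_left algebra_simps)

lemma affine_grad_has_derivative:
  assumes "affine_grad f g"
  shows "(f has_derivative (\<lambda>h. g \<bullet> h)) (at x)"
proof -
  have "((\<lambda>y. f 0 + g \<bullet> y) has_derivative (\<lambda>h. g \<bullet> h)) (at x)"
    by (auto intro!: derivative_eq_intros)
  then show ?thesis by (subst affine_grad_eq[OF assms])
qed

lemma affine_grad_poly2:
  assumes "affine_grad f g"
  shows "f \<in> poly2 1"
proof -
  have "f = (\<lambda>y. f 0 + (g $ 1 * y $ 1 + g $ 2 * y $ 2))"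
    by (subst affine_grad_eq[OF assms]) (simp add: inner_vec_def sum_2)
  also have "\<dots> \<in> poly2 1"
    by (intro poly2_add poly2_const poly2_scale poly2_coord)
  finally show ?thesis .
qed

lemma affine_grad_comb:
  assumes "affine_grad f g" "u + v + w = 1"
  shows "f (u *\<^sub>R a + v *\<^sub>R b + w *\<^sub>R c) = u * f a + v * f b + w * f c"
proof -
  have *: "f x = f 0 + g \<bullet> x" for x using affine_grad_eq[OF assms(1)] by (rule fun_cong)
  have "f 0 = (u + v + w) * f 0" using assms(2) by simp
  then show ?thesis
    unfolding *[of a] *[of b] *[of c] *[of "u *\<^sub>R a + v *\<^sub>R b + w *\<^sub>R c"]
    by (simp add: inner_add_right algebra_simps)
qed

text \<open>Two different values force a nonzero gradient, so the zero set is a line.\<close>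

lemma affine_grad_negligible:
  assumes "affine_grad f g" "f a \<noteq> f b"
  shows "negligible {x. f x = 0}"
proof -
  have "g \<noteq> 0" using affine_gradD[OF assms(1), of a b] assms(2) by auto
  then have "negligible {x. g \<bullet> x = - f 0}" by (auto intro: negligible_hyperplane)
  then show ?thesis
  proof (rule negligible_subset, clarify)
    fix x assume "f x = 0"
    then show "g \<bullet> x = - f 0" using affine_gradD[OF assms(1), of x 0] by simp
  qed
qed

text \<open>By affineness the coordinates of a convex combination are its weights; conversely,
  nonnegative coordinates are themselves admissible weights.\<close>

lemma convex_hull_3_barycentric:
  assumes aff: "affine_grad l0 g0" "affine_grad l1 g1" "affine_grad l2 g2"
    and sum: "\<And>x. l0 x + l1 x + l2 x = 1"
    and repr: "\<And>x. x = l0 x *\<^sub>R a + l1 x *\<^sub>R b + l2 x *\<^sub>R c"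
    and vals: "l0 a = 1" "l1 a = 0" "l2 a = 0" "l0 b = 0" "l1 b = 1" "l2 b = 0"
      "l0 c = 0" "l1 c = 0" "l2 c = 1"
  shows "convex hull {a, b, c} = {x. 0 \<le> l0 x \<and> 0 \<le> l1 x \<and> 0 \<le> l2 x}"
proof (intro equalityI subsetI)
  fix x assume "x \<in> convex hull {a, b, c}"
  then obtain u v w where *: "0 \<le> u" "0 \<le> v" "0 \<le> w" "u + v + w = 1"
    "x = u *\<^sub>R a + v *\<^sub>R b + w *\<^sub>R c" by (auto simp: convex_hull_3)
  show "x \<in> {x. 0 \<le> l0 x \<and> 0 \<le> l1 x \<and> 0 \<le> l2 x}"
    using * aff[THEN affine_grad_comb, OF *(4)] by (simp add: vals)
next
  fix x assume "x \<in> {x. 0 \<le> l0 x \<and> 0 \<le> l1 x \<and> 0 \<le> l2 x}"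
  then show "x \<in> convex hull {a, b, c}"
    unfolding convex_hull_3
    by (intro CollectI exI[of _ "l0 x"] exI[of _ "l1 x"] exI[of _ "l2 x"] conjI sum repr) auto
qed

section \<open>Indices of edges and their halves\<close>

definition I3 :: "nat set" where
  "I3 = {1, 2, 3}"

text \<open>A Boolean side lets one statement cover both halves of an edge, with negation exchanging
  its ends.\<close>

definition nbr :: "nat \<Rightarrow> bool \<Rightarrow> nat" where
  "nbr i s = (if s then nxt i else prv i)"

lemma nbr_simps:
  "nbr 1 s = (if s then 2 else 3)" "nbr 2 s = (if s then 3 else 1)" "nbr 3 s = (if s then 1 else 2)"
  by (simp_all add: nbr_def nxt_def prv_def)

lemma I3_cases:
  assumes "i \<in> I3"
  shows "nbr i s \<in> I3" "nbr i s \<noteq> i" "nbr i (\<not> s) \<noteq> nbr i s" "{i, nbr i s, nbr i (\<not> s)} = I3"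
  using assms by (cases s; auto simp: I3_def nbr_simps simp del: One_nat_def)+

text \<open>The construction uses the geometry only through these facts: \<open>lam\<close> are the
  barycentric coordinates of the triangle, \<open>lam_z0\<close> encodes that \<open>z 0\<close> is
  interior, and the positive weights place \<open>z (3 + i)\<close> strictly inside its
  edge.\<close>

locale ps_coordinates =
  fixes z :: "nat \<Rightarrow> real^2" and lam :: "nat \<Rightarrow> real^2 \<Rightarrow> real" and grd :: "nat \<Rightarrow> real^2"
    and wt :: "nat \<Rightarrow> bool \<Rightarrow> real"
  assumes lam_affine: "i \<in> I3 \<Longrightarrow> affine_grad (lam i) (grd i)"
    and lam_sum123: "lam 1 x + lam 2 x + lam 3 x = 1"
    and lam_repr123: "x = lam 1 x *\<^sub>R z 1 + lam 2 x *\<^sub>R z 2 + lam 3 x *\<^sub>R z 3"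
    and lam_z: "i \<in> I3 \<Longrightarrow> j \<in> I3 \<Longrightarrow> lam i (z j) = (if i = j then 1 else 0)"
    and lam_z0: "i \<in> I3 \<Longrightarrow> lam i (z 0) > 0"
    and wt_pos: "i \<in> I3 \<Longrightarrow> wt i s > 0"
    and wt_sum: "i \<in> I3 \<Longrightarrow> wt i s + wt i (\<not> s) = 1"
    and z_edge: "i \<in> I3 \<Longrightarrow> z (3 + i) = wt i s *\<^sub>R z (nbr i s) + wt i (\<not> s) *\<^sub>R z (nbr i (\<not> s))"
begin

section \<open>Coordinates adapted to an edge and its halves\<close>

lemma lam_sum: "i \<in> I3 \<Longrightarrow> lam i x + lam (nbr i s) x + lam (nbr i (\<not> s)) x = 1"
  using lam_sum123[of x] by (auto simp: I3_def nbr_simps simp del: One_nat_def)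

lemma lam_repr:
  "i \<in> I3 \<Longrightarrow>
    lam i x *\<^sub>R z i + lam (nbr i s) x *\<^sub>R z (nbr i s) + lam (nbr i (\<not> s)) x *\<^sub>R z (nbr i (\<not> s)) = x"
  using lam_repr123[of x, symmetric] by (auto simp: I3_def nbr_simps add_ac simp del: One_nat_def)

text \<open>The subtriangles are indexed by an edge \<open>i\<close> and a side \<open>s\<close> of \<open>z (3 + i)\<close>.
  The barycentric coordinates of the triangle with vertices \<open>z 0\<close>, \<open>z (3 + i)\<close>,
  \<open>z (nbr i s)\<close> are \<open>mu i\<close>, \<open>ph i s\<close>, \<open>ps i s\<close> in this order, and those of the triangle
  with vertices \<open>z 0\<close>, \<open>z (nxt i)\<close>, \<open>z (prv i)\<close> are \<open>mu i\<close>, \<open>al i True\<close>,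
  \<open>al i False\<close>. The prefix \<open>g\<close> denotes gradients.\<close>

definition mu :: "nat \<Rightarrow> real^2 \<Rightarrow> real" where
  "mu i x = inverse (lam i (z 0)) * lam i x"

definition al :: "nat \<Rightarrow> bool \<Rightarrow> real^2 \<Rightarrow> real" where
  "al i s x = lam (nbr i s) x - lam (nbr i s) (z 0) * mu i x"

definition ph :: "nat \<Rightarrow> bool \<Rightarrow> real^2 \<Rightarrow> real" where
  "ph i s x = inverse (wt i (\<not> s)) * al i (\<not> s) x"

definition ps :: "nat \<Rightarrow> bool \<Rightarrow> real^2 \<Rightarrow> real" where
  "ps i s x = al i s x - wt i s * ph i s x"

definition gmu :: "nat \<Rightarrow> real^2" where
  "gmu i = inverse (lam i (z 0)) *\<^sub>R grd i"

definition gal :: "nat \<Rightarrow> bool \<Rightarrow> real^2" where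
  "gal i s = grd (nbr i s) - lam (nbr i s) (z 0) *\<^sub>R gmu i"

definition gph :: "nat \<Rightarrow> bool \<Rightarrow> real^2" where
  "gph i s = inverse (wt i (\<not> s)) *\<^sub>R gal i (\<not> s)"

definition gps :: "nat \<Rightarrow> bool \<Rightarrow> real^2" where
  "gps i s = gal i s - wt i s *\<^sub>R gph i s"

context
  fixes i :: nat
  assumes i: "i \<in> I3"
begin

lemma affine_mu: "affine_grad (mu i) (gmu i)"
  unfolding mu_def gmu_def by (intro affine_grad_scale lam_affine i)

lemma affine_al: "affine_grad (al i s) (gal i s)"
  unfolding al_def gal_def by (intro affine_grad_scale affine_grad_diff lam_affine affine_mu I3_cases i)

lemma affine_ph: "affine_grad (ph i s) (gph i s)"
  unfolding ph_def gph_def by (intro affine_grad_scale affine_al)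

lemma affine_ps: "affine_grad (ps i s) (gps i s)"
  unfolding ps_def gps_def by (intro affine_grad_scale affine_grad_diff affine_al affine_ph)

lemma lam_eq_mu: "lam i x = lam i (z 0) * mu i x"
  using lam_z0[OF i] by (simp add: mu_def)

lemma al_not_eq: "al i (\<not> s) x = wt i (\<not> s) * ph i s x"
  using wt_pos[OF i, of "\<not> s"] by (simp add: ph_def)

lemma al_eq: "al i s x = wt i s * ph i s x + ps i s x"
  by (simp add: ps_def)

lemma al_sum: "mu i x + al i s x + al i (\<not> s) x = 1"
proof -
  have "lam (nbr i s) x + lam (nbr i (\<not> s)) x = 1 - lam i (z 0) * mu i x"
    using lam_sum[OF i, of x s] lam_eq_mu[of x] by simp
  moreover have "lam (nbr i s) (z 0) + lam (nbr i (\<not> s)) (z 0) = 1 - lam i (z 0)"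
    using lam_sum[OF i, of "z 0" s] by simp
  moreover have "mu i x + al i s x + al i (\<not> s) x = mu i x + (lam (nbr i s) x + lam (nbr i (\<not> s)) x)
      - (lam (nbr i s) (z 0) + lam (nbr i (\<not> s)) (z 0)) * mu i x"
    by (simp add: al_def algebra_simps)
  ultimately have "mu i x + al i s x + al i (\<not> s) x
      = mu i x + (1 - lam i (z 0) * mu i x) - (1 - lam i (z 0)) * mu i x" by presburger
  then show ?thesis by (simp add: algebra_simps)
qed

lemma piece_sum: "mu i x + ph i s x + ps i s x = 1"
proof -
  have "mu i x + (wt i s + wt i (\<not> s)) * ph i s x + ps i s x = 1"
    using al_sum[of x s] al_not_eq[of s x] al_eq[of s x] by (simp add: algebra_simps)
  then show ?thesis by (simp add: wt_sum i)
qed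

text \<open>Expressing \<open>lam\<close> through \<open>mu i\<close> and \<open>al i\<close>
  collects the barycentric representation of \<open>z 0\<close>, which gives the coordinates of the
  triangle over the whole edge. Replacing the far end of the edge by \<open>z (3 + i)\<close> passes
  to the subtriangle.\<close>

lemma piece_repr: "x = mu i x *\<^sub>R z 0 + ph i s x *\<^sub>R z (3 + i) + ps i s x *\<^sub>R z (nbr i s)"
proof -
  have "x = lam i x *\<^sub>R z i + lam (nbr i s) x *\<^sub>R z (nbr i s) + lam (nbr i (\<not> s)) x *\<^sub>R z (nbr i (\<not> s))"
    using lam_repr[OF i, of x s] by simp
  also have "lam (nbr i s) x = al i s x + lam (nbr i s) (z 0) * mu i x" by (simp add: al_def)
  also have "lam (nbr i (\<not> s)) x = al i (\<not> s) x + lam (nbr i (\<not> s)) (z 0) * mu i x" by (simp add: al_def)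
  also have "lam i x = lam i (z 0) * mu i x" by (rule lam_eq_mu)
  finally have "x = mu i x *\<^sub>R (lam i (z 0) *\<^sub>R z i + lam (nbr i s) (z 0) *\<^sub>R z (nbr i s)
      + lam (nbr i (\<not> s)) (z 0) *\<^sub>R z (nbr i (\<not> s)))
      + al i s x *\<^sub>R z (nbr i s) + al i (\<not> s) x *\<^sub>R z (nbr i (\<not> s))"
    by (simp add: algebra_simps)
  also have "\<dots> = mu i x *\<^sub>R z 0 + al i s x *\<^sub>R z (nbr i s) + al i (\<not> s) x *\<^sub>R z (nbr i (\<not> s))"
    by (simp add: lam_repr i)
  also have "\<dots> = mu i x *\<^sub>R z 0 + ph i s x *\<^sub>R z (3 + i) + ps i s x *\<^sub>R z (nbr i s)"
    unfolding al_not_eq[of s x] al_eq[of s x] z_edge[OF i, of s] by (simp add: algebra_simps)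
  finally show ?thesis .
qed

lemma lam_zedge: "j \<in> I3 \<Longrightarrow> lam j (z (3 + i)) = wt i s * lam j (z (nbr i s)) + wt i (\<not> s) * lam j (z (nbr i (\<not> s)))"
  using affine_grad_comb[OF lam_affine, of j "wt i s" "wt i (\<not> s)" 0] wt_sum[OF i, of s]
  by (simp add: z_edge[OF i, of s])

lemma mu_vals: "mu i (z 0) = 1" "mu i (z (3 + i)) = 0" "mu i (z (nbr i s)) = 0" "mu i (z i) = inverse (lam i (z 0))"
  using lam_z0[OF i] i I3_cases(1)[OF i] I3_cases(2)[OF i, symmetric] lam_zedge[of i True]
  by (auto simp: mu_def lam_z)

lemma al_vals: "al i s (z 0) = 0" "al i s (z (3 + i)) = wt i s" "al i s (z (nbr i s)) = 1"
    "al i s (z (nbr i (\<not> s))) = 0"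
  using mu_vals i I3_cases(1,3)[OF i, of s] I3_cases(1,3)[OF i, of "\<not> s"] lam_zedge[of "nbr i s" s]
  by (auto simp: al_def lam_z)

lemma ph_vals: "ph i s (z 0) = 0" "ph i s (z (3 + i)) = 1" "ph i s (z (nbr i s)) = 0"
  using al_vals[of "\<not> s"] wt_pos[OF i, of "\<not> s"] by (auto simp: ph_def)

lemma ps_vals: "ps i s (z 0) = 0" "ps i s (z (3 + i)) = 0" "ps i s (z (nbr i s)) = 1"
  using al_vals[of s] ph_vals[of s] by (auto simp: ps_def)

text \<open>Both functions vanish on the line through \<open>z 0\<close> and
  \<open>z (3 + i)\<close>, hence are proportional; the negative factor says that this line
  separates the two halves.\<close>

lemma ps_not: "wt i s * ps i (\<not> s) x = - (wt i (\<not> s) * ps i s x)"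
proof -
  have "wt i s * ps i (\<not> s) x = wt i s * al i (\<not> s) x - wt i (\<not> s) * (wt i s * ph i (\<not> s) x)"
    by (simp add: ps_def algebra_simps)
  moreover have "wt i (\<not> s) * ps i s x = wt i (\<not> s) * al i s x - wt i s * (wt i (\<not> s) * ph i s x)"
    by (simp add: ps_def algebra_simps)
  ultimately show ?thesis
    using al_not_eq[of s x] al_not_eq[of "\<not> s" x] by simp
qed

end

section \<open>The subtriangles and the cover of the triangle\<close>

definition piece :: "nat \<Rightarrow> bool \<Rightarrow> (real^2) set" where
  "piece i s = convex hull {z 0, z (3 + i), z (nbr i s)}"

lemma ps_split_eq: "ps_split z = {piece i s | i s. i \<in> I3}"
proof -
  have "{convex hull {z 0, z (nxt i), z (3 + i)}, convex hull {z 0, z (3 + i), z (prv i)}} = range (piece i)" for i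
    by (auto simp: piece_def nbr_def insert_commute UNIV_bool)
  then show ?thesis unfolding ps_split_def by (auto simp: I3_def)
qed

lemma piece_iff:
  assumes i: "i \<in> I3"
  shows "x \<in> piece i s \<longleftrightarrow> 0 \<le> mu i x \<and> 0 \<le> ph i s x \<and> 0 \<le> ps i s x"
  unfolding piece_def
  using convex_hull_3_barycentric[OF affine_mu[OF i] affine_ph[OF i, of s] affine_ps[OF i, of s]
      piece_sum[OF i, of _ s] piece_repr[OF i, of _ s]]
    mu_vals[OF i] ph_vals[OF i] ps_vals[OF i] by simp

lemma triangle_iff: "x \<in> ps_triangle z \<longleftrightarrow> (\<forall>i\<in>I3. 0 \<le> lam i x)"
  unfolding ps_triangle_def
  using convex_hull_3_barycentric[OF lam_affine lam_affine lam_affine lam_sum123 lam_repr123]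
  by (auto simp: lam_z I3_def)

lemma z_edge_in_piece: "i \<in> I3 \<Longrightarrow> z (3 + i) \<in> piece i s"
  by (simp add: piece_def hull_inc)

lemma piece_al_nonneg:
  assumes "i \<in> I3" "x \<in> piece i s"
  shows "0 \<le> al i s' x"
proof -
  have "0 \<le> ph i s x" "0 \<le> ps i s x" using assms by (simp_all add: piece_iff)
  then have "0 \<le> al i s x" "0 \<le> al i (\<not> s) x"
    using wt_pos[OF assms(1), of s] wt_pos[OF assms(1), of "\<not> s"]
      al_eq[OF assms(1), of s x] al_not_eq[OF assms(1), of s x]
    by simp_all
  then show ?thesis by (cases "s' = s") auto
qed

lemma piece_subset_triangle: "i \<in> I3 \<Longrightarrow> piece i s \<subseteq> ps_triangle z"
proof
  fix x assume i: "i \<in> I3" and x: "x \<in> piece i s"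
  have "0 \<le> mu i x" using x i by (simp add: piece_iff)
  then have "0 \<le> lam i x" using lam_eq_mu[OF i, of x] lam_z0[OF i] by simp
  moreover have "0 \<le> lam (nbr i t) x" for t
    using piece_al_nonneg[OF i x, of t] lam_z0[OF I3_cases(1)[OF i, of t]] \<open>0 \<le> mu i x\<close>
      mult_nonneg_nonneg[of "lam (nbr i t) (z 0)" "mu i x"]
    unfolding al_def by linarith
  ultimately show "x \<in> ps_triangle z"
    unfolding triangle_iff I3_cases(4)[OF i, of True, symmetric] by auto
qed

text \<open>The sign of \<open>al i s\<close> compares \<open>mu i\<close> with a neighbour, so the
  part of the triangle adjacent to edge \<open>i\<close> is where \<open>mu i\<close> is smallest.
  This is why the hat function is a minimum.\<close>

lemma al_eq_mu_diff:
  assumes "i \<in> I3"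
  shows "al i s x = lam (nbr i s) (z 0) * (mu (nbr i s) x - mu i x)"
  using lam_eq_mu[OF I3_cases(1)[OF assms, of s], of x] by (simp add: al_def algebra_simps)

lemma mu_le_on_piece:
  assumes i: "i \<in> I3" and "j \<in> I3" and x: "x \<in> piece i s"
  shows "mu i x \<le> mu j x"
proof -
  have "mu i x \<le> mu (nbr i t) x" for t
    using piece_al_nonneg[OF i x, of t] lam_z0[OF I3_cases(1)[OF i, of t]]
    by (simp add: al_eq_mu_diff i zero_le_mult_iff)
  then show ?thesis using assms(2) unfolding I3_cases(4)[OF i, of True, symmetric] by auto
qed

text \<open>The smallest \<open>mu i\<close> selects the edge. The sign of \<open>ps i\<close>
  selects the half: by \<open>ps_not\<close> the two sides cannot both be negative.\<close>

lemma triangle_cover: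
  assumes "x \<in> ps_triangle z"
  obtains i s where "i \<in> I3" "x \<in> piece i s"
proof -
  obtain i where i: "i \<in> I3" and min: "\<And>j. j \<in> I3 \<Longrightarrow> mu i x \<le> mu j x"
  proof -
    have "finite ((\<lambda>j. mu j x) ` I3)" by (simp add: I3_def)
    then have "Min ((\<lambda>j. mu j x) ` I3) \<in> (\<lambda>j. mu j x) ` I3" by (rule Min_in) (simp add: I3_def)
    then obtain i where "i \<in> I3" "mu i x = Min ((\<lambda>j. mu j x) ` I3)" by auto
    then show thesis using that by (metis Min_le \<open>finite _\<close> imageI)
  qed
  have mu: "0 \<le> mu i x"
    using assms i lam_z0[OF i] unfolding triangle_iff mu_def by auto
  have al: "0 \<le> al i t x" for t
    using min[OF I3_cases(1)[OF i, of t]] lam_z0[OF I3_cases(1)[OF i, of t]]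
    by (simp add: al_eq_mu_diff i)
  have ph: "0 \<le> ph i t x" for t
    using al[of "\<not> t"] wt_pos[OF i, of "\<not> t"] by (simp add: ph_def)
  have "0 \<le> ps i True x \<or> 0 \<le> ps i False x"
    using ps_not[OF i, of True x] wt_pos[OF i]
    by (smt (verit) mult_pos_neg mult_pos_pos)
  then obtain s where "0 \<le> ps i s x" by auto
  then show thesis using that[OF i] mu ph i by (simp add: piece_iff)
qed

text \<open>Truncation glues the affine pieces to hat functions that are Lipschitz on the whole plane,
  with no case distinction over the subtriangles.\<close>

definition Mu :: "real^2 \<Rightarrow> real" where
  "Mu x = max 0 (min (mu 1 x) (min (mu 2 x) (mu 3 x)))"

definition Ph :: "nat \<Rightarrow> real^2 \<Rightarrow> real" where
  "Ph i x = max 0 (min (ph i True x) (ph i False x))"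

definition Ps :: "nat \<Rightarrow> bool \<Rightarrow> real^2 \<Rightarrow> real" where
  "Ps i s x = max 0 (ps i s x)"

lemma Mu_on_piece: "i \<in> I3 \<Longrightarrow> x \<in> piece i s \<Longrightarrow> Mu x = mu i x"
  using mu_le_on_piece[of i 1 x s] mu_le_on_piece[of i 2 x s] mu_le_on_piece[of i 3 x s]
    piece_iff[of i x s]
  by (auto simp: Mu_def I3_def)

lemma Mu_eq_0:
  assumes "\<not> (\<forall>i\<in>I3. 0 < lam i x)"
  shows "Mu x = 0"
proof -
  obtain i where i: "i \<in> I3" "lam i x \<le> 0" using assms by fastforce
  then have "mu i x \<le> 0" using lam_z0[OF i(1)] by (simp add: mu_def mult_le_0_iff)
  then show ?thesis using i(1) by (auto simp: Mu_def I3_def)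
qed

lemma Mu_outside: "x \<notin> ps_triangle z \<Longrightarrow> Mu x = 0"
  by (rule Mu_eq_0) (meson triangle_iff less_imp_le)

text \<open>Positivity of all \<open>lam\<close> is an open condition and can hold only in the
  interior, so some \<open>lam i\<close> is nonpositive on the frontier.\<close>

lemma Mu_frontier:
  assumes "x \<in> frontier (ps_triangle z)"
  shows "Mu x = 0"
proof (rule Mu_eq_0, rule notI)
  assume pos: "\<forall>i\<in>I3. 0 < lam i x"
  have op: "open {y. 0 < lam i y}" if "i \<in> I3" for i
    using loc_lipschitz_continuous[OF loc_lipschitz_poly2[OF affine_grad_poly2[OF lam_affine[OF that]]]]
    by (intro open_Collect_less continuous_on_const)
  have "open ({y. 0 < lam 1 y} \<inter> {y. 0 < lam 2 y} \<inter> {y. 0 < lam 3 y})"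
    by (intro open_Int op) (simp_all add: I3_def)
  then have "x \<in> interior (ps_triangle z)"
    by (rule interiorI) (use pos in \<open>auto simp: triangle_iff I3_def intro: less_imp_le\<close>)
  then show False using assms by (simp add: frontier_def)
qed

lemma Ph_on_piece:
  assumes i: "i \<in> I3" and x: "x \<in> piece i s"
  shows "Ph i x = ph i s x"
proof -
  \<comment> \<open>The two affine branches differ by \<open>ps i s x / wt i s\<close>, so on the
    piece \<open>ph i s\<close> is the smaller one.\<close>
  have "wt i s * ph i (\<not> s) x = wt i s * ph i s x + ps i s x"
    using al_eq[OF i, of s x] al_not_eq[OF i, of "\<not> s" x] by simp
  then have "wt i s * ph i s x \<le> wt i s * ph i (\<not> s) x" using x i by (simp add: piece_iff)
  then have "ph i s x \<le> ph i (\<not> s) x" using wt_pos[OF i, of s] by simp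
  then show ?thesis using x i by (cases s) (auto simp: Ph_def piece_iff)
qed

text \<open>Where \<open>mu i\<close> is smallest, the function \<open>al j t\<close> with
  \<open>i = nbr j t\<close> is nonpositive; hence so is one branch of the minimum, and truncation
  gives zero.\<close>

lemma Ph_on_other_piece:
  assumes i: "i \<in> I3" and j: "j \<in> I3" and ne: "i \<noteq> j" and x: "x \<in> piece i s"
  shows "Ph j x = 0"
proof -
  obtain t where t: "i = nbr j t"
    using I3_cases(4)[OF j, of True] i ne by auto
  have "al j t x \<le> 0"
    using mu_le_on_piece[OF i j x] lam_z0[OF i] unfolding t by (simp add: al_eq_mu_diff j mult_le_0_iff)
  then have "ph j (\<not> t) x \<le> 0" using wt_pos[OF j, of t] by (simp add: ph_def mult_le_0_iff)
  then show ?thesis by (cases t) (auto simp: Ph_def)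
qed

lemma Ps_on_piece:
  assumes i: "i \<in> I3" and x: "x \<in> piece i s"
  shows "Ps i s x = ps i s x" "Ps i (\<not> s) x = 0"
proof -
  show "Ps i s x = ps i s x" using x i by (simp add: Ps_def piece_iff)
  have "wt i s * ps i (\<not> s) x \<le> 0"
    using ps_not[OF i, of s x] x wt_pos[OF i, of "\<not> s"] i by (simp add: piece_iff)
  then show "Ps i (\<not> s) x = 0" using wt_pos[OF i, of s] by (simp add: Ps_def mult_le_0_iff)
qed

section \<open>Reduction by powers of the hat function\<close>

text \<open>A global function is paired with its polynomial branches. Its regularity is recorded on
  the whole plane, so branches never have to be matched along edges.\<close>

definition pw :: "nat \<Rightarrow> (real^2 \<Rightarrow> real) \<Rightarrow> (nat \<Rightarrow> bool \<Rightarrow> real^2 \<Rightarrow> real) \<Rightarrow> bool" where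
  "pw r f F \<longleftrightarrow> loc_lipschitz f \<and>
     (\<forall>i\<in>I3. \<forall>s. F i s \<in> poly2 r \<and> (\<forall>x\<in>piece i s. f x = F i s x))"

definition pwv :: "nat \<Rightarrow> (real^2 \<Rightarrow> real^2) \<Rightarrow> (nat \<Rightarrow> bool \<Rightarrow> real^2 \<Rightarrow> real^2) \<Rightarrow> bool" where
  "pwv r v V \<longleftrightarrow> (\<forall>k. pw r (\<lambda>x. v x $ k) (\<lambda>i s x. V i s x $ k))"

lemma pw_add: "pw r f F \<Longrightarrow> pw r g G \<Longrightarrow> pw r (\<lambda>x. f x + g x) (\<lambda>i s x. F i s x + G i s x)"
  by (auto simp: pw_def loc_lipschitz_add poly2_add)

lemma pw_mult: "pw r f F \<Longrightarrow> pw q g G \<Longrightarrow> pw (r + q) (\<lambda>x. f x * g x) (\<lambda>i s x. F i s x * G i s x)"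
  by (auto simp: pw_def loc_lipschitz_mult poly2_mult)

lemma pw_poly2: "f \<in> poly2 r \<Longrightarrow> pw r f (\<lambda>i s. f)"
  by (auto simp: pw_def loc_lipschitz_poly2)

lemma pw_scale_right: "pw r f F \<Longrightarrow> pw r (\<lambda>x. f x * c) (\<lambda>i s x. F i s x * c)"
  using pw_mult[OF _ pw_poly2[OF poly2_const[of c 0]]] by simp

lemma pw_mono: "pw r f F \<Longrightarrow> r \<le> q \<Longrightarrow> pw q f F"
  by (auto simp: pw_def intro: poly2_mono)

lemma pwv_add: "pwv r v V \<Longrightarrow> pwv r w W \<Longrightarrow> pwv r (\<lambda>x. v x + w x) (\<lambda>i s x. V i s x + W i s x)"
  by (auto simp: pwv_def intro: pw_add)

lemma pwv_scaleR:
  "pw r f F \<Longrightarrow> pwv q v V \<Longrightarrow> pwv (r + q) (\<lambda>x. f x *\<^sub>R v x) (\<lambda>i s x. F i s x *\<^sub>R V i s x)"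
  by (auto simp: pwv_def intro: pw_mult)

lemma pwv_scaleR_const: "pw r f F \<Longrightarrow> pwv r (\<lambda>x. f x *\<^sub>R a) (\<lambda>i s x. F i s x *\<^sub>R a)"
  by (auto simp: pwv_def intro: pw_scale_right)

lemma pwv_vpoly2: "v \<in> vpoly2 r \<Longrightarrow> pwv r v (\<lambda>i s. v)"
  by (auto simp: pwv_def vpoly2_def intro: pw_poly2)

lemma pwvD:
  assumes "pwv r v V" "i \<in> I3"
  shows "V i s \<in> vpoly2 r" "x \<in> piece i s \<Longrightarrow> v x = V i s x"
    "V i s differentiable (at x)" "loc_lipschitz (\<lambda>x. v x $ k)"
proof -
  show 1: "V i s \<in> vpoly2 r" using assms by (auto simp: pwv_def pw_def vpoly2_def)
  then show "V i s differentiable (at x)" by (rule vpoly2_differentiable)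
  show "x \<in> piece i s \<Longrightarrow> v x = V i s x" using assms by (auto simp: pwv_def pw_def vec_eq_iff)
  show "loc_lipschitz (\<lambda>x. v x $ k)" using assms by (auto simp: pwv_def pw_def)
qed

lemma pw_Mu: "pw 1 Mu (\<lambda>i s. mu i)"
proof -
  have "loc_lipschitz (mu i)" if "i \<in> I3" for i
    using loc_lipschitz_poly2[OF affine_grad_poly2[OF affine_mu[OF that]]] .
  then have "loc_lipschitz Mu"
    unfolding Mu_def by (intro loc_lipschitz_max loc_lipschitz_min loc_lipschitz_const) (auto simp: I3_def)
  then show ?thesis
    using Mu_on_piece affine_grad_poly2[OF affine_mu] by (auto simp: pw_def)
qed

lemma pw_Mu_power: "pw k (\<lambda>x. Mu x ^ k) (\<lambda>i s x. mu i x ^ k)"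
proof (induction k)
  case (Suc k)
  then show ?case using pw_mult[OF pw_Mu Suc] by simp
qed (simp add: pw_poly2 poly2_const)

lemma ph_poly2: "i \<in> I3 \<Longrightarrow> ph i s \<in> poly2 1"
  by (rule affine_grad_poly2[OF affine_ph])

lemma ps_poly2: "i \<in> I3 \<Longrightarrow> ps i s \<in> poly2 1"
  by (rule affine_grad_poly2[OF affine_ps])

lemma loc_lipschitz_Ph: "i \<in> I3 \<Longrightarrow> loc_lipschitz (Ph i)"
  unfolding Ph_def
  by (intro loc_lipschitz_max loc_lipschitz_min loc_lipschitz_const loc_lipschitz_poly2[OF ph_poly2])

lemma loc_lipschitz_Ps: "i \<in> I3 \<Longrightarrow> loc_lipschitz (Ps i s)"
  unfolding Ps_def
  by (intro loc_lipschitz_max loc_lipschitz_const loc_lipschitz_poly2[OF ps_poly2])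

lemma pw_Ph:
  assumes j: "j \<in> I3"
  shows "pw 1 (Ph j) (\<lambda>i s x. if i = j then ph j s x else 0)"
  unfolding pw_def
proof (intro conjI ballI allI)
  show "loc_lipschitz (Ph j)" using j by (rule loc_lipschitz_Ph)
next
  fix i s assume i: "i \<in> I3"
  show "(\<lambda>x. if i = j then ph j s x else 0) \<in> poly2 1"
    using ph_poly2[OF j, of s] poly2_zero[of 1] by (cases "i = j") auto
  show "Ph j x = (if i = j then ph j s x else 0)" if "x \<in> piece i s" for x
    using Ph_on_piece[OF i that] Ph_on_other_piece[OF i j _ that] by auto
qed

text \<open>The truncated factors \<open>Ps j\<close> switch between \<open>D True\<close> and
  \<open>D False\<close> across the line from \<open>z 0\<close> to the edge point: on each half
  only one of them survives. Away from edge \<open>j\<close> the factor \<open>Ph j\<close>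
  annihilates everything.\<close>

lemma pw_bubble:
  assumes j: "j \<in> I3" and D: "\<And>s. D s \<in> poly2 r" "\<And>s. (\<lambda>x. ps j s x * D s x) \<in> poly2 r"
  shows "pw (Suc r) (\<lambda>x. Ph j x * (c + (Ps j True x * D True x + Ps j False x * D False x)))
    (\<lambda>i s x. if i = j then ph j s x * (c + ps j s x * D s x) else 0)"
  unfolding pw_def
proof (intro conjI ballI allI)
  show "loc_lipschitz (\<lambda>x. Ph j x * (c + (Ps j True x * D True x + Ps j False x * D False x)))"
    using j D by (intro loc_lipschitz_mult loc_lipschitz_add loc_lipschitz_const loc_lipschitz_Ph
        loc_lipschitz_Ps loc_lipschitz_poly2)
next
  fix i s assume i: "i \<in> I3"
  have "(\<lambda>x. ph j s x * (c + ps j s x * D s x)) \<in> poly2 (Suc r)"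
    by (intro poly2_mult_Suc poly2_add poly2_const D ph_poly2 j)
  then show "(\<lambda>x. if i = j then ph j s x * (c + ps j s x * D s x) else 0) \<in> poly2 (Suc r)"
    by (cases "i = j") (simp_all add: poly2_zero)
  fix x assume x: "x \<in> piece i s"
  show "Ph j x * (c + (Ps j True x * D True x + Ps j False x * D False x))
      = (if i = j then ph j s x * (c + ps j s x * D s x) else 0)"
  proof (cases "i = j")
    case True
    have "Ps j True x * D True x + Ps j False x * D False x = ps j s x * D s x"
      using Ps_on_piece[OF i x] True by (cases s) auto
    then show ?thesis using Ph_on_piece[OF i x] True by simp
  next
    case False
    then show ?thesis using Ph_on_other_piece[OF i j _ x] by simp
  qed
qed

text \<open>These are the branches of a function in \<open>V2\<close>. In contrast to
  \<open>pw\<close>, they are matched only at the edge points and may jump everywhere else.\<close>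

definition edge_cont :: "nat \<Rightarrow> (nat \<Rightarrow> bool \<Rightarrow> real^2 \<Rightarrow> real) \<Rightarrow> bool" where
  "edge_cont r P \<longleftrightarrow>
    (\<forall>i\<in>I3. (\<forall>s. P i s \<in> poly2 r) \<and> P i True (z (3 + i)) = P i False (z (3 + i)))"

lemma edge_contD:
  assumes "edge_cont r P" "i \<in> I3"
  shows "P i s \<in> poly2 r" "P i True (z (3 + i)) = P i False (z (3 + i))"
  using assms by (auto simp: edge_cont_def)

lemma edge_cont_add:
  "edge_cont r P \<Longrightarrow> edge_cont r Q \<Longrightarrow> edge_cont r (\<lambda>i s x. P i s x + Q i s x)"
  by (auto simp: edge_cont_def poly2_add)

lemma edge_cont_diff:
  "edge_cont r P \<Longrightarrow> edge_cont r Q \<Longrightarrow> edge_cont r (\<lambda>i s x. P i s x - Q i s x)"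
  by (auto simp: edge_cont_def poly2_diff)

section \<open>Prescribing normal components at corners and on edges\<close>

lemma mu_diff: "i \<in> I3 \<Longrightarrow> gmu i \<bullet> (x - y) = mu i x - mu i y"
  using affine_mu[of i] by (simp add: affine_grad_def)

lemma ph_diff: "i \<in> I3 \<Longrightarrow> gph i s \<bullet> (x - y) = ph i s x - ph i s y"
  using affine_ph[of i s] by (simp add: affine_grad_def)

lemma nbr_nbr: "i \<in> I3 \<Longrightarrow> nbr (nbr i s) (\<not> s) = i"
  by (cases s) (auto simp: I3_def nbr_simps simp del: One_nat_def)

text \<open>The gradients are normals of the two edges meeting at \<open>z j\<close>. The vector
  from \<open>z j\<close> to one neighbour runs along one of these edges and is tangential to it, so
  the two edge vectors form a dual basis up to scaling.\<close>

lemma normal_interpolation: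
  assumes j: "j \<in> I3"
  obtains a where "\<And>s. gmu (nbr j s) \<bullet> a = q s"
proof -
  \<comment> \<open>The factor \<open>lam (nbr j s) (z 0)\<close> cancels the value of
    \<open>mu (nbr j s)\<close> at the vertex \<open>z (nbr j s)\<close>.\<close>
  define b where "b s = (q s * lam (nbr j s) (z 0)) *\<^sub>R (z (nbr j s) - z j)" for s
  have b: "gmu (nbr j s) \<bullet> b t
      = q t * lam (nbr j t) (z 0) * (mu (nbr j s) (z (nbr j t)) - mu (nbr j s) (z j))" for s t
    unfolding b_def inner_scaleR_right mu_diff[OF I3_cases(1)[OF j]] ..
  have same: "gmu (nbr j s) \<bullet> b s = q s" for s
    unfolding b using I3_cases[OF j, of s] j lam_z0[of "nbr j s"]
    by (simp add: mu_def lam_z)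
  have other: "gmu (nbr j s) \<bullet> b (\<not> s) = 0" for s
    unfolding b using I3_cases(1-3)[OF j, of s] I3_cases(1-3)[OF j, of "\<not> s"] j
    by (simp add: mu_def lam_z)
  have "gmu (nbr j s) \<bullet> (b True + b False) = q s" for s
    using same[of s] other[of s] by (cases s) (simp_all add: inner_add_right)
  then show thesis by (rule that)
qed

text \<open>Multiplied by \<open>mu i x ^ k\<close>, the equation says that \<open>mu\<^sup>k P\<close> is
  \<open>div (mu\<^sup>k\<^sup>+\<^sup>1 w) + mu\<^sup>k\<^sup>+\<^sup>1 Q\<close> on each subtriangle.\<close>

definition reducible :: "nat \<Rightarrow> nat \<Rightarrow> (nat \<Rightarrow> bool \<Rightarrow> real^2 \<Rightarrow> real) \<Rightarrow> bool" where
  "reducible k r P \<longleftrightarrow> (\<exists>w W Q. pwv (Suc r) w W \<and> edge_cont r Q \<and>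
     (\<forall>i\<in>I3. \<forall>s x. P i s x =
        (real k + 1) * (gmu i \<bullet> W i s x) + mu i x * (divergence (W i s) x + Q i s x)))"

lemma reducible_cong:
  assumes "reducible k r P" and eq: "\<And>i s x. i \<in> I3 \<Longrightarrow> P' i s x = P i s x"
  shows "reducible k r P'"
proof -
  obtain w W Q where *: "pwv (Suc r) w W" "edge_cont r Q"
    "\<And>i s x. i \<in> I3 \<Longrightarrow> P i s x =
        (real k + 1) * (gmu i \<bullet> W i s x) + mu i x * (divergence (W i s) x + Q i s x)"
    using assms(1) unfolding reducible_def by blast
  show ?thesis unfolding reducible_def
    by (rule exI[of _ w], rule exI[of _ W], rule exI[of _ Q]) (simp add: *(1,2) eq *(3))
qed

lemma reducible_add:
  assumes "reducible k r P" "reducible k r P'"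
  shows "reducible k r (\<lambda>i s x. P i s x + P' i s x)"
proof -
  obtain w W Q w' W' Q' where *: "pwv (Suc r) w W" "pwv (Suc r) w' W'" "edge_cont r Q" "edge_cont r Q'"
    "\<And>i s x. i \<in> I3 \<Longrightarrow> P i s x =
        (real k + 1) * (gmu i \<bullet> W i s x) + mu i x * (divergence (W i s) x + Q i s x)"
    "\<And>i s x. i \<in> I3 \<Longrightarrow> P' i s x =
        (real k + 1) * (gmu i \<bullet> W' i s x) + mu i x * (divergence (W' i s) x + Q' i s x)"
    using assms unfolding reducible_def by blast
  show ?thesis unfolding reducible_def
  proof (intro exI conjI ballI allI)
    show "pwv (Suc r) (\<lambda>x. w x + w' x) (\<lambda>i s x. W i s x + W' i s x)" by (rule pwv_add) fact+
    show "edge_cont r (\<lambda>i s x. Q i s x + Q' i s x)" by (rule edge_cont_add) fact+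
    fix i s x assume i: "i \<in> I3"
    show "P i s x + P' i s x = (real k + 1) * (gmu i \<bullet> (W i s x + W' i s x))
      + mu i x * (divergence (\<lambda>x. W i s x + W' i s x) x + (Q i s x + Q' i s x))"
      unfolding *(5)[OF i] *(6)[OF i]
      by (simp add: divergence_add pwvD(3)[OF *(1) i] pwvD(3)[OF *(2) i] inner_add_right algebra_simps)
  qed
qed

text \<open>A linear field takes the value \<open>a j\<close> at \<open>z j\<close>, chosen so that
  both normal components there agree with \<open>P\<close>. Subtracting its contribution leaves a
  family vanishing at the corners, which can be treated edge by edge.\<close>

lemma reducible_corner_interpolant:
  assumes P: "edge_cont (Suc r) P"
  obtains P' where "reducible k r P'" "edge_cont (Suc r) P'"
    "\<And>i s. i \<in> I3 \<Longrightarrow> P' i s (z (nbr i s)) = P i s (z (nbr i s))"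
proof -
  \<comment> \<open>Seen from edge \<open>nbr j s\<close>, the corner \<open>z j\<close> lies on
    side \<open>\<not> s\<close>, by \<open>nbr_nbr\<close>.\<close>
  have "\<exists>a. \<forall>s. gmu (nbr j s) \<bullet> a = P (nbr j s) (\<not> s) (z j) / (real k + 1)" if "j \<in> I3" for j
    using normal_interpolation[OF that, of "\<lambda>s. P (nbr j s) (\<not> s) (z j) / (real k + 1)"] by metis
  then obtain a where a: "\<And>j s. j \<in> I3 \<Longrightarrow> gmu (nbr j s) \<bullet> a j = P (nbr j s) (\<not> s) (z j) / (real k + 1)"
    by metis
  define w where "w x = (\<Sum>j\<in>I3. lam j x *\<^sub>R a j)" for x
  have w1: "w \<in> vpoly2 1"
    unfolding w_def by (intro vpoly2_sum vpoly2_scaleR_const affine_grad_poly2[OF lam_affine])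
  then have wr: "w \<in> vpoly2 (Suc r)" by (rule vpoly2_mono) simp
  have div: "divergence w \<in> poly2 r"
    using vpoly2_has_derivative(2)[of w 0] w1 by (auto intro: poly2_mono)
  have div': "(\<lambda>x. - divergence w x) \<in> poly2 r"
    using poly2_scale[OF div, of "- 1"] by simp
  have wz: "w (z j) = a j" if "j \<in> I3" for j
  proof -
    have "w (z j) = (\<Sum>i\<in>I3. if i = j then a j else 0)"
      unfolding w_def using that by (intro sum.cong) (auto simp: lam_z)
    then show ?thesis using that by (simp add: I3_def)
  qed
  define P' where "P' i s x = (real k + 1) * (gmu i \<bullet> w x)" for i :: nat and s :: bool and x
  \<comment> \<open>The choice \<open>Q = - divergence w\<close> makes the term with factor
    \<open>mu i\<close> vanish. It is a single polynomial, so it matches at the edge points.\<close>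
  have "reducible k r P'"
    unfolding reducible_def
    by (rule exI[of _ w], rule exI[of _ "\<lambda>i s. w"], rule exI[of _ "\<lambda>i s x. - divergence w x"])
      (auto simp: pwv_vpoly2 wr P'_def edge_cont_def intro: div')
  moreover have "edge_cont (Suc r) P'"
    by (auto simp: edge_cont_def P'_def[abs_def] intro!: poly2_scale poly2_inner wr)
  moreover have "P' i s (z (nbr i s)) = P i s (z (nbr i s))" if i: "i \<in> I3" for i s
    using a[OF I3_cases(1)[OF i, of s], of "\<not> s"] by (simp add: P'_def wz nbr_nbr i I3_cases)
  ultimately show thesis by (rule that)
qed

text \<open>The normal component of the bubble field is prescribed on the edge by \<open>P\<close>. Its tangential
  component at \<open>z (3 + j)\<close>, scaled by \<open>\<gamma>\<close>, is the free parameter that makes the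
  quotient continuous there.\<close>

lemma reducible_bubble:
  assumes P: "edge_cont (Suc r) P" and j: "j \<in> I3" and corner: "\<And>s. P j s (z (nbr j s)) = 0"
  shows "reducible k r (\<lambda>i s x. if i = j then P i s x else 0)"
proof -
  let ?e = "z (3 + j)"
  have sum1: "ps j s x + mu j x + ph j s x = 1" "ph j s x + mu j x + ps j s x = 1" for s x
    using piece_sum[OF j, of x s] by auto
  have repr1: "x = ps j s x *\<^sub>R z (nbr j s) + mu j x *\<^sub>R z 0 + ph j s x *\<^sub>R ?e"
    "x = ph j s x *\<^sub>R ?e + mu j x *\<^sub>R z 0 + ps j s x *\<^sub>R z (nbr j s)" for s x
    using piece_repr[OF j, of x s, symmetric] by (simp_all add: add_ac)
  \<comment> \<open>Expansion about the corner: \<open>mu j\<close> and \<open>ph j s\<close> vanish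
    there, and so does the constant term.\<close>
  have "\<exists>f g. f \<in> poly2 r \<and> g \<in> poly2 r \<and> (\<forall>x. P j s x = mu j x * f x + ph j s x * g x)" for s
  proof (rule poly2_expand_Suc[OF sum1(1)[of s] repr1(1)[of _ s] mu_vals(3)[OF j] ph_vals(3)[OF j]
            edge_contD(1)[OF P j, of s]])
    fix f g assume "f \<in> poly2 r" "g \<in> poly2 r"
      "\<And>x. P j s x = P j s (z (nbr j s)) + mu j x * f x + ph j s x * g x"
    then show ?thesis unfolding corner add_0_left by blast
  qed
  then obtain f g where fg: "\<And>s. f s \<in> poly2 r" "\<And>s. g s \<in> poly2 r"
    "\<And>s x. P j s x = mu j x * f s x + ph j s x * g s x" by metis
  \<comment> \<open>Since \<open>mu j\<close> is 0 and \<open>ph j s\<close> is 1 at the edge point,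
    \<open>g s\<close> takes the value of \<open>P j s\<close> there. Continuity of \<open>P\<close>
    makes this value \<open>c\<close> the same on both sides.\<close>
  define c where "c = g True ?e"
  have ge: "g s ?e = P j s ?e" for s
    unfolding fg(3) mu_vals(2)[OF j] ph_vals(2)[OF j] by simp
  have c: "g s ?e = c" for s
    using ge[of True] ge[of False] edge_contD(2)[OF P j] by (cases s) (simp_all only: c_def)
  \<comment> \<open>Expansion of \<open>g s\<close> about the edge point. The part with factor
    \<open>mu j\<close> is moved into the quotient; the rest equals \<open>c\<close> on the line
    \<open>ps j s = 0\<close> between the halves, so the functions \<open>B s\<close> below glue
    continuously.\<close>
  define split where "split s E D \<longleftrightarrow> D \<in> poly2 r \<and> (\<lambda>x. ph j s x * E x) \<in> poly2 r \<and>
      (\<lambda>x. ps j s x * D x) \<in> poly2 r \<and> (\<forall>x. g s x = c + mu j x * E x + ps j s x * D x)" for s E D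
  have "\<exists>E D. split s E D" for s
  proof (rule poly2_expand[OF sum1(2)[of s] repr1(2)[of _ s] mu_vals(2)[OF j] ps_vals(2)[OF j] fg(2)[of s]])
    fix E D assume ED: "E \<in> poly2 r" "D \<in> poly2 r"
      "\<And>a. a \<in> poly2 1 \<Longrightarrow> (\<lambda>x. a x * E x) \<in> poly2 r"
      "\<And>a. a \<in> poly2 1 \<Longrightarrow> (\<lambda>x. a x * D x) \<in> poly2 r"
      "\<And>x. g s x = g s ?e + mu j x * E x + ps j s x * D x"
    show ?thesis
      using ED(5) unfolding c split_def
      by (intro exI[of _ E] exI[of _ D] conjI ED(2) ED(3)[OF ph_poly2[OF j]] ED(4)[OF ps_poly2[OF j]]) blast
  qed
  then obtain E D where "\<And>s. split s (E s) (D s)" by metis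
  then have ED: "\<And>s. D s \<in> poly2 r" "\<And>s. (\<lambda>x. ph j s x * E s x) \<in> poly2 r"
    "\<And>s. (\<lambda>x. ps j s x * D s x) \<in> poly2 r" "\<And>s x. g s x = c + mu j x * E s x + ps j s x * D s x"
    by (simp_all add: split_def)
  \<comment> \<open>The function \<open>mu j\<close> rises by 1 from the edge point to
    \<open>z 0\<close>; the scaling offsets the factor \<open>k + 1\<close> from differentiating the
    power.\<close>
  define n where "n = (1 / (real k + 1)) *\<^sub>R (z 0 - ?e)"
  define \<tau> where "\<tau> = z (nbr j True) - z (nbr j False)"
  have n: "(real k + 1) * (gmu j \<bullet> n) = 1"
    by (simp add: n_def mu_diff j mu_vals)
  have \<tau>: "gmu j \<bullet> \<tau> = 0" by (simp add: \<tau>_def mu_diff j mu_vals)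
  \<comment> \<open>The opposite strict signs keep the denominator of \<open>\<gamma>\<close> away
    from zero.\<close>
  have g\<tau>: "gph j True \<bullet> \<tau> < 0" "0 < gph j False \<bullet> \<tau>"
    using wt_pos[OF j] al_vals(3,4)[OF j, of True] al_vals(3,4)[OF j, of False]
    unfolding \<tau>_def ph_diff[OF j] by (simp_all add: ph_def)
  define B where "B s x = ph j s x * (c + ps j s x * D s x)" for s x
  define U where "U s x = B s x *\<^sub>R n" for s x
  \<comment> \<open>This would be the quotient for the normal part alone. The tangential part lowers
    it on side \<open>s\<close> by the constant
    \<open>\<gamma> * (gph j s \<bullet> \<tau>)\<close>, and \<open>\<gamma>\<close> is solved from
    equality of the two sides at the edge point.\<close>
  define J where "J s x = f s x + ph j s x * E s x - divergence (U s) x" for s x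
  define \<gamma> where "\<gamma> = (J True ?e - J False ?e) / (gph j True \<bullet> \<tau> - gph j False \<bullet> \<tau>)"
  define W where "W i s x = (if i = j then B s x else 0) *\<^sub>R n + (if i = j then ph j s x else 0) *\<^sub>R (\<gamma> *\<^sub>R \<tau>)" for i s x
  have BS: "B s \<in> poly2 (Suc r)" for s
    unfolding B_def by (intro poly2_mult_Suc poly2_add poly2_const ED ph_poly2 j)
  have US: "U s \<in> vpoly2 (Suc r)" for s
    unfolding U_def by (intro vpoly2_scaleR_const BS)
  obtain w where w: "pwv (Suc r) w W"
  proof
    show "pwv (Suc r) (\<lambda>x. (Ph j x * (c + (Ps j True x * D True x + Ps j False x * D False x))) *\<^sub>R n
        + Ph j x *\<^sub>R (\<gamma> *\<^sub>R \<tau>)) W"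
      unfolding W_def B_def
      by (intro pwv_add pwv_scaleR_const pw_bubble j ED pw_mono[OF pw_Ph]) simp
  qed
  have divW: "divergence (W j s) x = divergence (U s) x + \<gamma> * (gph j s \<bullet> \<tau>)" for s x
  proof -
    have "divergence (\<lambda>x. U s x + ph j s x *\<^sub>R (\<gamma> *\<^sub>R \<tau>)) x
        = divergence (U s) x + divergence (\<lambda>x. ph j s x *\<^sub>R (\<gamma> *\<^sub>R \<tau>)) x"
      by (intro divergence_add vpoly2_differentiable[OF US]
          vpoly2_differentiable[OF vpoly2_scaleR_const[OF ph_poly2]] j)
    moreover have "divergence (\<lambda>x. ph j s x *\<^sub>R (\<gamma> *\<^sub>R \<tau>)) x = \<gamma> * (gph j s \<bullet> \<tau>)"
      unfolding divergence_scaleR_const[OF affine_grad_has_derivative[OF affine_ph[OF j]]] by simp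
    moreover have "W j s = (\<lambda>x. U s x + ph j s x *\<^sub>R (\<gamma> *\<^sub>R \<tau>))" by (auto simp: W_def U_def)
    ultimately show ?thesis by simp
  qed
  define Q where "Q i s x = (if i = j then J s x - \<gamma> * (gph j s \<bullet> \<tau>) else 0)" for i s x
  have "edge_cont r Q"
    unfolding edge_cont_def
  proof (intro ballI conjI allI)
    fix i s
    have "(\<lambda>x. J s x - \<gamma> * (gph j s \<bullet> \<tau>)) \<in> poly2 r"
      unfolding J_def
      by (intro poly2_diff poly2_add fg ED poly2_const vpoly2_has_derivative(2) US)
    then show "Q i s \<in> poly2 r" by (cases "i = j") (simp_all add: Q_def[abs_def] poly2_zero)
    have "J True ?e - J False ?e = \<gamma> * (gph j True \<bullet> \<tau> - gph j False \<bullet> \<tau>)"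
      using g\<tau> by (simp add: \<gamma>_def)
    then show "Q i True (z (3 + i)) = Q i False (z (3 + i))" by (simp add: Q_def algebra_simps)
  qed
  moreover have "(if i = j then P i s x else 0) =
      (real k + 1) * (gmu i \<bullet> W i s x) + mu i x * (divergence (W i s) x + Q i s x)"
    if "i \<in> I3" for i s x
  proof (cases "i = j")
    case True
    have "(real k + 1) * (gmu j \<bullet> W j s x) = B s x * ((real k + 1) * (gmu j \<bullet> n))"
      using \<tau> by (simp add: W_def inner_add_right)
    then have "(real k + 1) * (gmu j \<bullet> W j s x) = B s x" using n by simp
    moreover have "divergence (W j s) x + Q j s x = f s x + ph j s x * E s x"
      by (simp add: divW Q_def J_def)
    ultimately have "(real k + 1) * (gmu j \<bullet> W j s x) + mu j x * (divergence (W j s) x + Q j s x)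
        = ph j s x * (c + ps j s x * D s x) + mu j x * (f s x + ph j s x * E s x)"
      by (simp only: B_def)
    also have "\<dots> = P j s x" unfolding fg(3) ED(4) by (simp add: algebra_simps)
    finally show ?thesis using True by simp
  next
    case False
    then have "W i s = (\<lambda>x. 0)" by (auto simp: W_def)
    then show ?thesis using False by (simp add: Q_def divergence_const)
  qed
  ultimately show ?thesis unfolding reducible_def using w by blast
qed

text \<open>The difference from the corner interpolant vanishes at all corners. It is therefore the
  sum of three families, each living over one edge and removed by a bubble field.\<close>

lemma edge_cont_reducible:
  assumes P: "edge_cont (Suc r) P"
  shows "reducible k r P"
proof -
  obtain P' where P': "reducible k r P'" "edge_cont (Suc r) P'"
    "\<And>i s. i \<in> I3 \<Longrightarrow> P' i s (z (nbr i s)) = P i s (z (nbr i s))"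
    using reducible_corner_interpolant[OF P] by metis
  define R where "R i s x = P i s x - P' i s x" for i s x
  have R: "edge_cont (Suc r) R" unfolding R_def by (intro edge_cont_diff P P')
  have b: "reducible k r (\<lambda>i s x. if i = j then R i s x else 0)" if "j \<in> I3" for j
    by (intro reducible_bubble R that) (simp add: R_def P' that)
  have I3: "1 \<in> I3" "2 \<in> I3" "3 \<in> I3" by (simp_all add: I3_def)
  have "P i s x = P' i s x + ((if i = 1 then R i s x else 0) + ((if i = 2 then R i s x else 0)
      + (if i = 3 then R i s x else 0)))" if "i \<in> I3" for i s x
    using that by (auto simp: I3_def R_def)
  then show ?thesis
    by (rule reducible_cong[OF reducible_add[OF P'(1) reducible_add[OF b[OF I3(1)]
            reducible_add[OF b[OF I3(2)] b[OF I3(3)]]]]])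
qed

section \<open>Iterating the reduction down to constants\<close>

lemma divergence_mu_power_scaleR:
  assumes i: "i \<in> I3" and v: "v differentiable (at x)"
  shows "divergence (\<lambda>x. mu i x ^ Suc k *\<^sub>R v x) x
    = mu i x ^ k * ((real k + 1) * (gmu i \<bullet> v x) + mu i x * divergence v x)"
proof -
  have "((\<lambda>x. mu i x ^ Suc k) has_derivative (\<lambda>h. (real k + 1) * mu i x ^ k * (gmu i \<bullet> h))) (at x)"
    by (rule has_derivative_eq_rhs[OF has_derivative_power[OF affine_grad_has_derivative[OF affine_mu[OF i]]]])
      (auto simp: fun_eq_iff algebra_simps)
  from divergence_scaleR[OF this v] show ?thesis by (simp add: algebra_simps)
qed

text \<open>Induction on the degree with \<open>k\<close> arbitrary: one reduction leaves
  \<open>mu i x ^ Suc k * Q i s x\<close>, the same problem with exponent raised and degree lowered.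
  The field of the next stage has one more factor of the hat function, hence
  \<open>w + Mu w'\<close>.\<close>

lemma edge_cont_reduction:
  assumes "edge_cont r P"
  shows "\<exists>w W c. pwv r w W \<and> (\<forall>i\<in>I3. \<forall>s x. mu i x ^ k * P i s x
    = divergence (\<lambda>x. mu i x ^ Suc k *\<^sub>R W i s x) x + mu i x ^ (k + r) * c i)"
  using assms
proof (induction r arbitrary: k P)
  case 0
  \<comment> \<open>At degree zero, matching at one point identifies the constants of both
    halves.\<close>
  have eq: "P i s x = P i True (z (3 + i))" if "i \<in> I3" for i s x
  proof -
    have "P i s x = P i s (z (3 + i))" by (rule poly2_0E[OF edge_contD(1)[OF 0 that]])
    also have "\<dots> = P i True (z (3 + i))" using edge_contD(2)[OF 0 that] by (cases s) simp_all
    finally show ?thesis .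
  qed
  show ?case
  proof (intro exI conjI ballI allI)
    show "pwv 0 (\<lambda>x. 0) (\<lambda>i s x. 0)" by (intro pwv_vpoly2 vpoly2_const)
    fix i s x assume i: "i \<in> I3"
    show "mu i x ^ k * P i s x
      = divergence (\<lambda>x. mu i x ^ Suc k *\<^sub>R 0) x + mu i x ^ (k + 0) * P i True (z (3 + i))"
      by (subst eq[OF i, of s x]) (simp add: divergence_const)
  qed
next
  case (Suc r)
  obtain w W Q where 1: "pwv (Suc r) w W" "edge_cont r Q"
    "\<And>i s x. i \<in> I3 \<Longrightarrow> P i s x =
        (real k + 1) * (gmu i \<bullet> W i s x) + mu i x * (divergence (W i s) x + Q i s x)"
    using edge_cont_reducible[OF Suc.prems, of k] unfolding reducible_def by blast
  obtain w' W' c where 2: "pwv r w' W'"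
    "\<And>i s x. i \<in> I3 \<Longrightarrow> mu i x ^ Suc k * Q i s x
      = divergence (\<lambda>x. mu i x ^ Suc (Suc k) *\<^sub>R W' i s x) x + mu i x ^ (Suc k + r) * c i"
    using Suc.IH[OF 1(2), of "Suc k"] by blast
  show ?case
  proof (intro exI conjI ballI allI)
    show "pwv (Suc r) (\<lambda>x. w x + Mu x *\<^sub>R w' x) (\<lambda>i s x. W i s x + mu i x *\<^sub>R W' i s x)"
      using pwv_scaleR[OF pw_Mu 2(1)] 1(1) by (auto intro: pwv_add)
    fix i s x assume i: "i \<in> I3"
    have d: "W i s differentiable (at x)" "W' i s differentiable (at x)"
      using pwvD(3)[OF 1(1) i] pwvD(3)[OF 2(1) i] by auto
    have p: "(\<lambda>x. mu i x ^ m) \<in> poly2 m" for m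
      using poly2_power[OF affine_grad_poly2[OF affine_mu[OF i]], of m] by simp
    have "divergence (\<lambda>x. mu i x ^ Suc k *\<^sub>R (W i s x + mu i x *\<^sub>R W' i s x)) x
      = divergence (\<lambda>x. mu i x ^ Suc k *\<^sub>R W i s x + mu i x ^ Suc (Suc k) *\<^sub>R W' i s x) x"
      by (simp add: scaleR_add_right mult_ac)
    also have "\<dots> = divergence (\<lambda>x. mu i x ^ Suc k *\<^sub>R W i s x) x
        + divergence (\<lambda>x. mu i x ^ Suc (Suc k) *\<^sub>R W' i s x) x"
      by (rule divergence_add[OF vpoly2_differentiable[OF vpoly2_scaleR[OF p pwvD(1)[OF 1(1) i]]]
          vpoly2_differentiable[OF vpoly2_scaleR[OF p pwvD(1)[OF 2(1) i]]]])
    finally show "mu i x ^ k * P i s x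
      = divergence (\<lambda>x. mu i x ^ Suc k *\<^sub>R (W i s x + mu i x *\<^sub>R W' i s x)) x + mu i x ^ (k + Suc r) * c i"
      using 2(2)[OF i, of x s] unfolding 1(3)[OF i] divergence_mu_power_scaleR[OF i d(1)]
      by (simp add: algebra_simps)
  qed
qed

lemma edge_cont_divergence_mod_piece:
  assumes P: "edge_cont r P"
  shows "\<exists>v V d. pwv (Suc r) v V \<and> (\<forall>x. Mu x = 0 \<longrightarrow> v x = 0) \<and>
    (\<forall>i\<in>I3. \<forall>s x. P i s x = divergence (V i s) x + mu i x ^ r * (if i = 1 then d else 0))"
proof -
  have "\<exists>w W c. pwv r w W \<and> (\<forall>i\<in>I3. \<forall>s x. P i s x
      = divergence (\<lambda>x. mu i x *\<^sub>R W i s x) x + mu i x ^ r * c i)"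
    using edge_cont_reduction[OF P, of 0] by simp
  then obtain w W c where W: "pwv r w W"
    "\<And>i s x. i \<in> I3 \<Longrightarrow> P i s x = divergence (\<lambda>x. mu i x *\<^sub>R W i s x) x + mu i x ^ r * c i"
    by blast
  have 1: "1 \<in> I3" by (simp add: I3_def)
  \<comment> \<open>The divergence of \<open>mu i x ^ Suc r *\<^sub>R a\<close> is
    \<open>(r + 1) * mu i x ^ r * (gmu i \<bullet> a)\<close>. Interpolation at \<open>z 1\<close>
    lets it match the constants of the other two edges.\<close>
  obtain a where a: "\<And>s. gmu (nbr 1 s) \<bullet> a = c (nbr 1 s) / (real r + 1)"
    using normal_interpolation[OF 1, of "\<lambda>s. c (nbr 1 s) / (real r + 1)"] by metis
  define d where "d i = c i - (real r + 1) * (gmu i \<bullet> a)" for i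
  have d: "d i = (if i = 1 then d 1 else 0)" if "i \<in> I3" for i
  proof -
    have "d (nbr 1 s) = 0" for s using a[of s] by (simp add: d_def)
    then show ?thesis using that unfolding I3_cases(4)[OF 1, of True, symmetric] by auto
  qed
  show ?thesis
  proof (intro exI conjI allI ballI impI)
    show "pwv (Suc r) (\<lambda>x. Mu x *\<^sub>R w x + Mu x ^ Suc r *\<^sub>R a)
      (\<lambda>i s x. mu i x *\<^sub>R W i s x + mu i x ^ Suc r *\<^sub>R a)"
      using pwv_scaleR[OF pw_Mu W(1)] pwv_scaleR_const[OF pw_Mu_power[of "Suc r"]]
      by (auto intro: pwv_add)
    show "Mu x *\<^sub>R w x + Mu x ^ Suc r *\<^sub>R a = 0" if "Mu x = 0" for x using that by simp
    fix i s x assume i: "i \<in> I3"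
    have m: "mu i \<in> poly2 1" using affine_grad_poly2[OF affine_mu[OF i]] .
    have p: "(\<lambda>x. mu i x ^ m) \<in> poly2 m" for m
      using poly2_power[OF m, of m] by simp
    have "divergence (\<lambda>x. mu i x *\<^sub>R W i s x + mu i x ^ Suc r *\<^sub>R a) x
      = divergence (\<lambda>x. mu i x *\<^sub>R W i s x) x + divergence (\<lambda>x. mu i x ^ Suc r *\<^sub>R a) x"
      by (rule divergence_add[OF vpoly2_differentiable[OF vpoly2_scaleR[OF m pwvD(1)[OF W(1) i]]]
          vpoly2_differentiable[OF vpoly2_scaleR_const[OF p]]])
    also have "divergence (\<lambda>x. mu i x ^ Suc r *\<^sub>R a) x = mu i x ^ r * (c i - d i)"
      using divergence_mu_power_scaleR[OF i, of "\<lambda>x. a" x r] by (simp add: divergence_const d_def)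
    finally show "P i s x = divergence (\<lambda>x. mu i x *\<^sub>R W i s x + mu i x ^ Suc r *\<^sub>R a) x
      + mu i x ^ r * (if i = 1 then d 1 else 0)"
      unfolding W(2)[OF i] d[OF i, symmetric] by (simp add: algebra_simps)
  qed
qed

section \<open>Passage to almost everywhere identities\<close>

lemma compact_triangle: "compact (ps_triangle z)"
  unfolding ps_triangle_def by (intro finite_imp_compact_convex_hull) simp

lemma compact_piece: "compact (piece i s)"
  unfolding piece_def by (intro finite_imp_compact_convex_hull) simp

lemma AE_lebesgue_on_iff:
  "compact S \<Longrightarrow> (AE x in lebesgue_on S. Q x) \<longleftrightarrow> (AE x in lebesgue. x \<in> S \<longrightarrow> Q x)"
  for S :: "(real^2) set"
  using fmeasurableD[OF lmeasurable_compact[of S]] by (intro AE_restrict_space_iff) simp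

text \<open>On these open sets a glued field agrees with one polynomial field near each point, so
  derivatives can be read off from the branch.\<close>

definition opiece :: "nat \<Rightarrow> bool \<Rightarrow> (real^2) set" where
  "opiece i s = {x. 0 < mu i x \<and> 0 < ph i s x \<and> 0 < ps i s x}"

lemma opiece_subset: "i \<in> I3 \<Longrightarrow> opiece i s \<subseteq> piece i s"
  by (auto simp: opiece_def piece_iff less_imp_le)

lemma open_opiece:
  assumes i: "i \<in> I3"
  shows "open (opiece i s)"
proof -
  have "open {x. 0 < f x}" if "affine_grad f g" for f g
    using loc_lipschitz_continuous[OF loc_lipschitz_poly2[OF affine_grad_poly2[OF that]]]
    by (intro open_Collect_less continuous_on_const)
  note this[OF affine_mu[OF i]] this[OF affine_ph[OF i, of s]] this[OF affine_ps[OF i, of s]]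
  then have "open ({x. 0 < mu i x} \<inter> {x. 0 < ph i s x} \<inter> {x. 0 < ps i s x})"
    by (intro open_Int)
  moreover have "opiece i s = {x. 0 < mu i x} \<inter> {x. 0 < ph i s x} \<inter> {x. 0 < ps i s x}"
    by (auto simp: opiece_def)
  ultimately show ?thesis by simp
qed

lemma opiece_nonempty:
  assumes i: "i \<in> I3"
  shows "opiece i s \<noteq> {}"
proof -
  have "(1/3) *\<^sub>R z 0 + (1/3) *\<^sub>R z (3 + i) + (1/3) *\<^sub>R z (nbr i s) \<in> opiece i s"
    unfolding opiece_def using mu_vals[OF i] ph_vals[OF i] ps_vals[OF i]
      affine_grad_comb[OF affine_mu[OF i], of "1/3" "1/3" "1/3" "z 0" "z (3 + i)" "z (nbr i s)"]
      affine_grad_comb[OF affine_ph[OF i], of "1/3" "1/3" "1/3" s "z 0" "z (3 + i)" "z (nbr i s)"]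
      affine_grad_comb[OF affine_ps[OF i], of "1/3" "1/3" "1/3" s "z 0" "z (3 + i)" "z (nbr i s)"]
    by simp
  then show ?thesis by blast
qed

text \<open>Only the finitely many lines carrying sides of subtriangles are lost.\<close>

lemma AE_in_opiece: "AE x in lebesgue. x \<in> ps_triangle z \<longrightarrow> (\<exists>i\<in>I3. \<exists>s. x \<in> opiece i s)"
proof -
  define N where "N = (\<Union>i\<in>I3. \<Union>s\<in>UNIV. {x. mu i x = 0} \<union> {x. ph i s x = 0} \<union> {x. ps i s x = 0})"
  have "negligible {x. mu i x = 0}" "negligible {x. ph i s x = 0}" "negligible {x. ps i s x = 0}"
    if i: "i \<in> I3" for i s
    using affine_grad_negligible[OF affine_mu[OF i], of "z 0" "z (3 + i)"]
      affine_grad_negligible[OF affine_ph[OF i], of s "z 0" "z (3 + i)"]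
      affine_grad_negligible[OF affine_ps[OF i], of s "z 0" "z (nbr i s)"]
      mu_vals[OF i] ph_vals[OF i] ps_vals[OF i] by auto
  moreover have "finite I3" by (simp add: I3_def)
  ultimately have "negligible N"
    unfolding N_def by (intro negligible_Union finite_imageI ballI finite_UNIV) (auto intro!: negligible_Union)
  then have "AE x in lebesgue. x \<notin> N"
    by (intro AE_not_in) (simp add: negligible_iff_null_sets)
  then show ?thesis
  proof (rule AE_mp, intro AE_I2 impI)
    fix x assume x: "x \<notin> N" "x \<in> ps_triangle z"
    obtain i s where i: "i \<in> I3" "x \<in> piece i s" using triangle_cover[OF x(2)] by metis
    then have "x \<in> opiece i s"
      using x(1) unfolding N_def opiece_def piece_iff[OF i(1)] by (auto simp: less_le)
    then show "\<exists>i\<in>I3. \<exists>s. x \<in> opiece i s" using i by blast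
  qed
qed

section \<open>Divergence of the glued fields\<close>

lemma pwv_divergence:
  assumes v: "pwv r v V" and i: "i \<in> I3" and x: "x \<in> opiece i s"
  shows "v differentiable (at x)" "divergence v x = divergence (V i s) x"
proof -
  obtain V' where V': "(V i s has_derivative V') (at x)"
    using pwvD(3)[OF v i] by (auto simp: differentiable_def)
  have "(v has_derivative V') (at x)"
    by (rule has_derivative_transform_within_open[OF V' open_opiece[OF i] x])
      (use pwvD(2)[OF v i] opiece_subset[OF i] in fastforce)
  then show "v differentiable (at x)" "divergence v x = divergence (V i s) x"
    using divergence_eq[OF V'] divergence_eq by (auto intro: differentiableI)
qed

lemma divergence_outside:
  assumes v: "\<And>x. x \<notin> ps_triangle z \<Longrightarrow> v x = 0" and x: "x \<notin> ps_triangle z"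
  shows "v differentiable (at x)" "divergence v x = 0"
proof -
  have op: "open (- ps_triangle z)" using compact_triangle by (simp add: compact_imp_closed open_Compl)
  have "((\<lambda>x. 0) has_derivative (\<lambda>h. 0)) (at x)" by simp
  then have "(v has_derivative (\<lambda>h. 0)) (at x)"
    by (rule has_derivative_transform_within_open[OF _ op]) (use v x in auto)
  then show "v differentiable (at x)" "divergence v x = 0"
    using divergence_eq by (auto intro: differentiableI)
qed

lemma AE_differentiable:
  assumes v: "pwv r v V" "\<And>x. x \<notin> ps_triangle z \<Longrightarrow> v x = 0"
  shows "AE x in lebesgue. v differentiable (at x)"
  using AE_in_opiece
proof (rule AE_mp, intro AE_I2 impI)
  fix x assume "x \<in> ps_triangle z \<longrightarrow> (\<exists>i\<in>I3. \<exists>s. x \<in> opiece i s)"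
  then show "v differentiable (at x)"
    using pwv_divergence(1)[OF v(1)] divergence_outside(1)[of v x] v(2) by blast
qed

text \<open>The field vanishes on the open complement of the triangle, hence so does
  \<open>D\<close>, and the integral over the plane is the integral over the triangle.\<close>

lemma integral_divergence_triangle:
  assumes v: "pwv r v V" "\<And>x. x \<notin> ps_triangle z \<Longrightarrow> v x = 0"
  shows "\<exists>D. integrable (lebesgue_on (ps_triangle z)) D \<and>
    integral\<^sup>L (lebesgue_on (ps_triangle z)) D = 0 \<and>
    (\<forall>x. v differentiable (at x) \<longrightarrow> D x = divergence v x)"
proof -
  let ?T = "ps_triangle z"
  obtain R where R: "\<And>x. x \<in> ?T \<Longrightarrow> norm x \<le> R"
    using compact_imp_bounded[OF compact_triangle] by (auto simp: bounded_iff)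
  have I1: "1 \<in> I3" by (simp add: I3_def)
  obtain D where D: "integrable lborel D" "(\<integral>x. D x \<partial>lborel) = 0"
    "\<And>x. v differentiable (at x) \<Longrightarrow> D x = divergence v x"
  proof (rule integral_divergence_eq_0[of v R])
    show "loc_lipschitz (\<lambda>x. v x $ k)" for k by (rule pwvD(4)[OF v(1) I1])
    show "v x = 0" if "norm x > R" for x using v(2) R that by force
    show "AE x in lborel. v differentiable (at x)"
      using AE_differentiable[OF v] by (simp add: AE_completion_iff)
  qed blast
  have meas: "D \<in> borel_measurable lborel" using D(1) by simp
  have T: "?T \<in> sets lebesgue" by (rule fmeasurableD[OF lmeasurable_compact[OF compact_triangle]])
  have Dl: "integrable lebesgue D" using D(1) by (simp add: integrable_completion)
  have out: "D x = 0" if "x \<notin> ?T" for x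
    using D(3)[OF divergence_outside(1)[OF v(2) that]] divergence_outside(2)[OF v(2) that] by simp
  then have ind: "(\<lambda>x. indicator ?T x * D x) = D" by (auto simp: indicator_def fun_eq_iff)
  show ?thesis
  proof (intro exI conjI allI impI)
    show "integrable (lebesgue_on ?T) D"
      using Dl T by (simp add: integrable_restrict_space ind)
    show "integral\<^sup>L (lebesgue_on ?T) D = 0"
      using T D(2) meas by (simp add: integral_restrict_space ind integral_completion)
  qed (rule D(3))
qed

section \<open>Transfer to the function spaces and conclusion\<close>

lemma finite_measure_triangle: "finite_measure (lebesgue_on (ps_triangle z))"
  by (intro finite_measure_lebesgue_on lmeasurable_compact compact_triangle)

lemma L2_triangle_integrable:
  assumes "q \<in> L2 (ps_triangle z)"
  shows "integrable (lebesgue_on (ps_triangle z)) q"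
proof -
  interpret finite_measure "lebesgue_on (ps_triangle z)" by (rule finite_measure_triangle)
  have q: "q \<in> borel_measurable (lebesgue_on (ps_triangle z))"
    "integrable (lebesgue_on (ps_triangle z)) (\<lambda>x. (q x)\<^sup>2)" using assms by (auto simp: L2_def)
  have "norm (q x) \<le> norm (1 + (q x)\<^sup>2)" for x
  proof -
    have "0 \<le> (\<bar>q x\<bar> - 1)\<^sup>2" "0 \<le> (q x)\<^sup>2" by simp_all
    then show ?thesis by (simp add: power2_diff)
  qed
  then show ?thesis
    by (intro Bochner_Integration.integrable_bound[OF Bochner_Integration.integrable_add[OF integrable_const[of 1] q(2)] q(1)])
      simp
qed

lemma continuous_L2_triangle:
  assumes f: "continuous_on UNIV f"
  shows "f \<in> L2 (ps_triangle z)"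
proof -
  let ?M = "lebesgue_on (ps_triangle z)"
  interpret finite_measure ?M by (rule finite_measure_triangle)
  have T: "ps_triangle z \<in> sets lebesgue" by (rule fmeasurableD[OF lmeasurable_compact[OF compact_triangle]])
  have fT: "continuous_on (ps_triangle z) f" using f continuous_on_subset by blast
  have m: "f \<in> borel_measurable ?M"
    by (rule continuous_imp_measurable_on_sets_lebesgue[OF fT T])
  have "bounded (f ` ps_triangle z)"
    by (intro compact_imp_bounded compact_continuous_image fT compact_triangle)
  then obtain B where B: "\<And>x. x \<in> ps_triangle z \<Longrightarrow> \<bar>f x\<bar> \<le> B" by (auto simp: bounded_iff)
  have "integrable ?M (\<lambda>x. (f x)\<^sup>2)"
  proof (rule integrable_const_bound)
    show "AE x in ?M. norm ((f x)\<^sup>2) \<le> B\<^sup>2"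
      using B by (intro AE_I2) (auto simp: space_restrict_space intro!: power2_le_iff_abs_le[THEN iffD2] order_trans[OF abs_ge_zero])
  qed (use m in measurable)
  then show ?thesis using m by (simp add: L2_def)
qed

lemma pwv_L1_ring:
  assumes v: "pwv r v V" "\<And>x. Mu x = 0 \<Longrightarrow> v x = 0"
  shows "v \<in> L1_ring r z"
proof -
  have I1: "1 \<in> I3" by (simp add: I3_def)
  have c: "continuous_on UNIV (\<lambda>x. v x $ k)" for k
    by (rule loc_lipschitz_continuous[OF pwvD(4)[OF v(1) I1]])
  have "\<exists>f\<in>poly2 r. restricts_to (\<lambda>x. v x $ k) S f" if S: "S \<in> ps_split z" for S k
  proof -
    obtain i s where i: "i \<in> I3" "S = piece i s" using S by (auto simp: ps_split_eq)
    have "(\<lambda>x. V i s x $ k) \<in> poly2 r" using pwvD(1)[OF v(1) i(1)] by (simp add: vpoly2_def)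
    moreover have "restricts_to (\<lambda>x. v x $ k) S (\<lambda>x. V i s x $ k)"
      unfolding restricts_to_def i(2) using pwvD(2)[OF v(1) i(1)] by (intro AE_I2) (simp add: space_restrict_space)
    ultimately show ?thesis by blast
  qed
  then show ?thesis
    unfolding L1_ring_def pw_poly_def
    using continuous_L2_triangle[OF c] continuous_on_subset[OF c] v(2) Mu_frontier by auto
qed

text \<open>Continuity in \<open>V2\<close> is stated for all polynomial representatives, so it
  applies to the chosen branches; the finitely many exceptional null sets are merged.\<close>

lemma V2_ring_pieces:
  assumes p: "p \<in> V2_ring r z"
  obtains P where "edge_cont r P" "AE x in lebesgue. \<forall>i\<in>I3. \<forall>s. x \<in> piece i s \<longrightarrow> p x = P i s x"
proof -
  have "\<exists>f\<in>poly2 r. restricts_to p (piece i s) f" if "i \<in> I3" for i s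
    using p that unfolding V2_ring_def V2_def pw_poly_def by (auto simp: ps_split_eq)
  then obtain P where P: "\<And>i s. i \<in> I3 \<Longrightarrow> P i s \<in> poly2 r"
    "\<And>i s. i \<in> I3 \<Longrightarrow> restricts_to p (piece i s) (P i s)" by metis
  have "P i True (z (3 + i)) = P i False (z (3 + i))" if i: "i \<in> I3" for i
  proof -
    have "piece i s \<in> ps_split z" for s using i by (auto simp: ps_split_eq)
    moreover have "z (3 + i) \<in> piece i True \<inter> piece i False" using z_edge_in_piece[OF i] by auto
    ultimately show ?thesis
      using p i P[OF i] unfolding V2_ring_def V2_def I3_def[symmetric] by blast
  qed
  then have "edge_cont r P" using P(1) by (simp add: edge_cont_def)
  moreover have "AE x in lebesgue. \<forall>i\<in>I3. \<forall>s. x \<in> piece i s \<longrightarrow> p x = P i s x"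
  proof -
    have "AE x in lebesgue. x \<in> piece i s \<longrightarrow> p x = P i s x" if "i \<in> I3" for i s
      using P(2)[OF that] unfolding restricts_to_def AE_lebesgue_on_iff[OF compact_piece] .
    then show ?thesis
      by (auto simp: I3_def all_bool_eq intro!: AE_conjI)
  qed
  ultimately show thesis by (rule that)
qed

text \<open>Up to null sets, \<open>p\<close> differs from the divergence of the constructed field
  by \<open>d * mu 1 ^ r\<close> over the first edge and by nothing over the others. This difference
  has one sign and mean zero, which forces \<open>d = 0\<close>.\<close>

lemma V2_ring_is_divergence:
  assumes p: "p \<in> V2_ring r z"
  shows "\<exists>v\<in>L1_ring (r + 1) z. has_divergence_on v p (ps_triangle z)"
proof -
  let ?T = "ps_triangle z"
  obtain P where P: "edge_cont r P" "AE x in lebesgue. \<forall>i\<in>I3. \<forall>s. x \<in> piece i s \<longrightarrow> p x = P i s x"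
    by (rule V2_ring_pieces[OF p]) (rule that)
  obtain v V d where v: "pwv (Suc r) v V" "\<And>x. Mu x = 0 \<Longrightarrow> v x = 0"
    and PV: "\<And>i s x. i \<in> I3 \<Longrightarrow> P i s x = divergence (V i s) x + mu i x ^ r * (if i = 1 then d else 0)"
    using edge_cont_divergence_mod_piece[OF P(1)] by blast
  have out: "v x = 0" if "x \<notin> ?T" for x using v(2) Mu_outside that by blast
  have AE: "AE x in lebesgue. x \<in> ?T \<longrightarrow> v differentiable (at x) \<and>
      (\<exists>i\<in>I3. \<exists>s. x \<in> opiece i s \<and> p x = divergence v x + mu i x ^ r * (if i = 1 then d else 0))"
    using AE_in_opiece P(2)
  proof eventually_elim
    case (elim x)
    show ?case
    proof
      assume "x \<in> ?T"
      then obtain i s where i: "i \<in> I3" "x \<in> opiece i s" using elim(1) by blast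
      have "p x = P i s x" using elim(2) i opiece_subset[OF i(1)] by blast
      also have "\<dots> = divergence v x + mu i x ^ r * (if i = 1 then d else 0)"
        unfolding PV[OF i(1)] pwv_divergence(2)[OF v(1) i] ..
      finally show "v differentiable (at x) \<and>
          (\<exists>i\<in>I3. \<exists>s. x \<in> opiece i s \<and> p x = divergence v x + mu i x ^ r * (if i = 1 then d else 0))"
        using i pwv_divergence(1)[OF v(1) i] by blast
    qed
  qed
  have "\<exists>D. integrable (lebesgue_on ?T) D \<and> integral\<^sup>L (lebesgue_on ?T) D = 0 \<and>
    (\<forall>x. v differentiable (at x) \<longrightarrow> D x = divergence v x)"
    by (rule integral_divergence_triangle[OF v(1)]) (rule out)
  then obtain D where D: "integrable (lebesgue_on ?T) D" "integral\<^sup>L (lebesgue_on ?T) D = 0"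
    "\<And>x. v differentiable (at x) \<Longrightarrow> D x = divergence v x"
    by blast
  have pint: "integrable (lebesgue_on ?T) p" "integral\<^sup>L (lebesgue_on ?T) p = 0"
    using p L2_triangle_integrable by (auto simp: V2_ring_def V2_def pw_poly_def)
  \<comment> \<open>The factor \<open>sgn d\<close> makes the difference nonnegative almost
    everywhere, and its integral is zero because those of \<open>p\<close> and \<open>D\<close>
    are.\<close>
  define h where "h x = sgn d * (p x - D x)" for x
  have "integrable (lebesgue_on ?T) h" "integral\<^sup>L (lebesgue_on ?T) h = 0"
    unfolding h_def using D pint by auto
  moreover have "AE x in lebesgue_on ?T. 0 \<le> h x"
    unfolding AE_lebesgue_on_iff[OF compact_triangle] using AE
  proof eventually_elim
    case (elim x)
    show ?case
    proof
      assume x: "x \<in> ?T"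
      with elim obtain i s where i: "i \<in> I3" "x \<in> opiece i s"
        "p x = divergence v x + mu i x ^ r * (if i = 1 then d else 0)" "v differentiable (at x)" by blast
      then have "h x = mu i x ^ r * (if i = 1 then sgn d * d else 0)"
        by (simp add: h_def D(3))
      moreover have "0 < mu i x" using i by (simp add: opiece_def)
      ultimately show "0 \<le> h x" by (simp add: sgn_mult_self_eq zero_le_mult_iff sgn_if)
    qed
  qed
  ultimately have h0: "AE x in lebesgue_on ?T. h x = 0"
    using integral_nonneg_eq_0_iff_AE by blast
  have d0: "d = 0"
  proof (rule ccontr)
    \<comment> \<open>For nonzero \<open>d\<close> the function \<open>h\<close> would be positive
      on \<open>opiece 1 True\<close>, so this nonempty open set would be negligible.\<close>
    assume d: "d \<noteq> 0"
    have I1: "1 \<in> I3" by (simp add: I3_def)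
    have "AE x in lebesgue. x \<notin> opiece 1 True"
      using h0[unfolded AE_lebesgue_on_iff[OF compact_triangle]] P(2)
    proof eventually_elim
      case (elim x)
      show ?case
      proof
        assume x: "x \<in> opiece 1 True"
        have xp: "x \<in> piece 1 True" using x opiece_subset[OF I1] by blast
        have "p x = P 1 True x" using elim(2) xp I1 by blast
        also have "\<dots> = divergence v x + mu 1 x ^ r * d"
          using PV[OF I1, of True x] pwv_divergence(2)[OF v(1) I1 x] by simp
        also have "divergence v x = D x" using D(3)[OF pwv_divergence(1)[OF v(1) I1 x]] by simp
        finally have "h x = sgn d * (mu 1 x ^ r * d)" by (simp add: h_def)
        moreover have "h x = 0" using elim(1) piece_subset_triangle[OF I1] xp by blast
        moreover have "0 < mu 1 x" using x by (simp add: opiece_def)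
        ultimately show False using d by (simp add: sgn_zero_iff)
      qed
    qed
    then have "negligible (opiece 1 True)"
      using AE_iff_null_sets[of "opiece 1 True" lebesgue] open_opiece[OF I1]
      by (simp add: negligible_iff_null_sets)
    then show False using open_not_negligible[OF open_opiece[OF I1]] opiece_nonempty[OF I1] by blast
  qed
  have "has_divergence_on v p ?T"
    unfolding has_divergence_on_def AE_lebesgue_on_iff[OF compact_triangle]
    using AE by eventually_elim (auto simp: d0)
  moreover have "v \<in> L1_ring (r + 1) z" using pwv_L1_ring[OF v] by simp
  ultimately show ?thesis by blast
qed

end

section \<open>Construction of the coordinates from a Powell--Sabin configuration\<close>

lemma powell_sabin_coordinates:
  assumes ps: "powell_sabin z"
  obtains lam grd wt where "ps_coordinates z lam grd wt"
proof -
  define cr where "cr a b = a $ 1 * b $ 2 - a $ 2 * b $ 1" for a b :: "real^2"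
  define A where "A = cr (z 2 - z 1) (z 3 - z 1)"
  have A: "A > 0" using ps by (simp add: powell_sabin_def det_2 A_def cr_def)
  \<comment> \<open>Barycentric coordinates are ratios of signed areas, \<open>A\<close> being twice
    the area of the triangle. The gradient is the opposite edge, turned by a right angle and divided
    by \<open>A\<close>.\<close>
  define lam where "lam i x = cr (z (nxt i) - x) (z (prv i) - x) / A" for i x
  define grd where "grd i = (vector [(z (nxt i) - z (prv i)) $ 2 / A, (z (prv i) - z (nxt i)) $ 1 / A] :: real^2)" for i
  have shift: "nxt 1 = 2" "nxt 2 = 3" "nxt 3 = 1" "prv 1 = 3" "prv 2 = 1" "prv 3 = 2"
    by (simp_all add: nxt_def prv_def)
  have aff: "affine_grad (lam i) (grd i)" for i
    unfolding affine_grad_def lam_def grd_def cr_def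
    by (simp add: inner_vec_def sum_2 diff_divide_distrib[symmetric] add_divide_distrib[symmetric])
       (simp add: algebra_simps)
  have A': "cr (z 2 - x) (z 3 - x) + cr (z 3 - x) (z 1 - x) + cr (z 1 - x) (z 2 - x) = A" for x
    by (simp add: A_def cr_def algebra_simps)
  have sum: "lam 1 x + lam 2 x + lam 3 x = 1" for x
    unfolding lam_def shift add_divide_distrib[symmetric] A' using A by simp
  have repr': "A *\<^sub>R x = cr (z 2 - x) (z 3 - x) *\<^sub>R z 1 + cr (z 3 - x) (z 1 - x) *\<^sub>R z 2 + cr (z 1 - x) (z 2 - x) *\<^sub>R z 3" for x
    by (simp add: A_def vec_eq_iff forall_2 cr_def algebra_simps)
  have repr: "x = lam 1 x *\<^sub>R z 1 + lam 2 x *\<^sub>R z 2 + lam 3 x *\<^sub>R z 3" for x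
  proof -
    have "x = (1 / A) *\<^sub>R (A *\<^sub>R x)" using A by simp
    also have "\<dots> = lam 1 x *\<^sub>R z 1 + lam 2 x *\<^sub>R z 2 + lam 3 x *\<^sub>R z 3"
      unfolding repr' lam_def shift by (simp add: scaleR_add_right)
    finally show ?thesis .
  qed
  have vals: "lam i (z j) = (if i = j then 1 else 0)" if "i \<in> I3" "j \<in> I3" for i j
  proof -
    have "cr (z 3 - z 2) (z 1 - z 2) = A" "cr (z 1 - z 3) (z 2 - z 3) = A" "cr (z 2 - z 1) (z 3 - z 1) = A"
      by (simp_all add: A_def cr_def algebra_simps)
    moreover have "cr 0 a = 0" "cr a 0 = 0" for a by (simp_all add: cr_def)
    ultimately show ?thesis
      using that A unfolding I3_def lam_def by (elim insertE) (simp_all add: shift del: One_nat_def)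
  qed
  have T: "ps_triangle z = {x. 0 \<le> lam 1 x \<and> 0 \<le> lam 2 x \<and> 0 \<le> lam 3 x}"
    unfolding ps_triangle_def
    by (rule convex_hull_3_barycentric[OF aff aff aff sum repr]) (simp_all add: vals I3_def)
  have pos: "lam i (z 0) > 0" if i: "i \<in> I3" for i
  proof -
    \<comment> \<open>The triangle lies in the half-plane where \<open>lam i\<close> is nonnegative.
      As the gradient is nonzero, the interior lies in the open half-plane, which makes the
      coordinate of \<open>z 0\<close> positive.\<close>
    have eq: "lam i x = lam i 0 + grd i \<bullet> x" for x using fun_cong[OF affine_grad_eq[OF aff]] .
    have "lam i (z i) \<noteq> lam i (z (nbr i True))" using i I3_cases[OF i, of True] by (simp add: vals)
    then have "grd i \<noteq> 0" using affine_gradD[OF aff, of i "z i" "z (nbr i True)"] by auto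
    moreover have "ps_triangle z \<subseteq> {x. grd i \<bullet> x \<ge> - lam i 0}"
    proof
      fix x assume "x \<in> ps_triangle z"
      then have "0 \<le> lam i x" using i by (auto simp: T I3_def)
      then show "x \<in> {x. grd i \<bullet> x \<ge> - lam i 0}" using eq[of x] by simp
    qed
    moreover have "z 0 \<in> interior (ps_triangle z)" using ps by (simp add: powell_sabin_def)
    ultimately have "z 0 \<in> {x. grd i \<bullet> x > - lam i 0}"
      using interior_mono interior_halfspace_ge by blast
    then show ?thesis using eq[of "z 0"] by simp
  qed
  have "\<exists>u. 0 < u \<and> u < 1 \<and> z (3 + i) = (1 - u) *\<^sub>R z (nxt i) + u *\<^sub>R z (prv i)" if i: "i \<in> I3" for i
  proof -
    \<comment> \<open>Distinct ends ensure that the relative interior of the edge is the open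
      segment, which gives strict bounds on the weight \<open>u\<close>.\<close>
    have "lam (nbr i True) (z (nbr i True)) \<noteq> lam (nbr i True) (z (nbr i False))"
      using I3_cases[OF i, of True] I3_cases[OF i, of False] by (auto simp: vals)
    then have "z (nxt i) \<noteq> z (prv i)" by (auto simp: nbr_def)
    moreover have "z (3 + i) \<in> rel_interior (closed_segment (z (nxt i)) (z (prv i)))"
      using ps i unfolding powell_sabin_def I3_def by blast
    ultimately have "z (3 + i) \<in> open_segment (z (nxt i)) (z (prv i))"
      by (simp add: rel_interior_closed_segment)
    then show ?thesis by (auto simp: in_segment)
  qed
  then obtain u where u: "\<And>i. i \<in> I3 \<Longrightarrow> 0 < u i" "\<And>i. i \<in> I3 \<Longrightarrow> u i < 1"
    "\<And>i. i \<in> I3 \<Longrightarrow> z (3 + i) = (1 - u i) *\<^sub>R z (nxt i) + u i *\<^sub>R z (prv i)" by metis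
  have "ps_coordinates z lam grd (\<lambda>i s. if s then 1 - u i else u i)"
  proof
    show "z (3 + i) = (if s then 1 - u i else u i) *\<^sub>R z (nbr i s)
        + (if \<not> s then 1 - u i else u i) *\<^sub>R z (nbr i (\<not> s))" if "i \<in> I3" for i s
      using u(3)[OF that] by (cases s) (simp_all add: nbr_def add.commute)
  qed (use aff sum repr vals pos u in auto)
  then show thesis by (rule that)
qed

theorem theorem3p7:
  fixes r :: nat and z :: "nat \<Rightarrow> real^2" and p :: "real^2 \<Rightarrow> real"
  assumes "powell_sabin z" and "p \<in> V2_ring r z"
  shows "\<exists>v\<in>L1_ring (r + 1) z. has_divergence_on v p (ps_triangle z)"
  using powell_sabin_coordinates[OF assms(1)] ps_coordinates.V2_ring_is_divergence assms(2) by metis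

end
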